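(* Let $m,r,b>0$, $0<D_0\le D_1$, $T<\infty$, and let $W$ be a standard Brownian motion. For $\epsilon>0$ let $(q^\epsilon,\sigma^\epsilon)$ be defined on $[0,T]$ by $q^\epsilon(0)=0$, $\sigma^\epsilon(0)=0$, $$dq^\epsilon(t)=\begin{cases} m\,dt+D_0\,dW_t & \text{if } \sigma^\epsilon(t)=0,\\ -\tfrac{r}{\epsilon}\,dt+D_1\,dW_t & \text{if } \sigma^\epsilon(t)=r/\epsilon,\end{cases}$$ where $\sigma^\epsilon$ takes values in $\{0,r/\epsilon\}$, switches from $0$ to $r/\epsilon$ when $q^\epsilon$ hits $b$ and back to $0$ when $q^\epsilon$ next hits $0$, repeatedly (extend $\sigma^\epsilon$ by $0$ for $t>T$). Let $E_t$ solve $dE_t=m\,dt+D_0\,dW_t$, $E_0=0$ (same $W$), let $\tau_k^d=\inf\{t>0: E(t)=kb\}$ for $k\in\mathbb{N}$, let $\mathcal{N}(T)$ be the number of $k$ with $\tau_k^d\le T$, and define the point process $$\sigma(t)=b\sum_{i=1}^{\mathcal{N}(T)}\delta(t-\tau_i^d).$$ Then for every test function $\phi\in C_c^\infty(0,\infty)$, $$\lim_{\epsilon\to0}\mathbb{E}\left[\left|\langle\sigma^\epsilon,\phi\rangle-\langle\sigma,\phi\rangle\right|^2\right]=0,\qquad\text{where }\langle f,g\rangle=\int_0^\infty f(t)g(t)\,dt$$ (so $\langle\sigma,\phi\rangle=b\sum_{i=1}^{\mathcal{N}(T)}\phi(\tau_i^d)$). *)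

theory Defs
  imports "HOL-Probability.Probability"
begin

definition brownian_motion :: "'a measure \<Rightarrow> (real \<Rightarrow> 'a \<Rightarrow> real) \<Rightarrow> bool" where
  "brownian_motion M W \<longleftrightarrow> prob_space M \<and>
     (\<forall>\<omega>\<in>space M. W 0 \<omega> = 0 \<and> continuous_on {0..} (\<lambda>t. W t \<omega>)) \<and>
     (\<forall>s t. 0 \<le> s \<and> s < t \<longrightarrow>
        distributed M lborel (\<lambda>\<omega>. W t \<omega> - W s \<omega>)
          (\<lambda>x. ennreal (normal_density 0 (sqrt (t - s)) x))) \<and>
     (\<forall>(n::nat) (ts::nat \<Rightarrow> real). 0 \<le> ts 0 \<and> strict_mono ts \<longrightarrow>
        prob_space.indep_vars M (\<lambda>_. borel) (\<lambda>i \<omega>. W (ts (Suc i)) \<omega> - W (ts i) \<omega>) {..<n})"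

definition test_fun_pos :: "(real \<Rightarrow> real) \<Rightarrow> bool" where
  "test_fun_pos \<phi> \<longleftrightarrow> (\<forall>k x. ((deriv ^^ k) \<phi>) differentiable (at x)) \<and>
     (\<exists>a c. 0 < a \<and> a \<le> c \<and> (\<forall>x. x \<notin> {a..c} \<longrightarrow> \<phi> x = 0))"

text \<open>Pathwise characterisation of the switched SDE for (q^eps, sigma^eps) driven by the
  Brownian path w, on [0,T]; sigma^eps is extended by 0 for t > T.
  sigma(t) = r/eps iff q has hit b at some time s <= t and has not hit 0 during [s,t]
  (switch to r/eps at hitting b, back to 0 at the next hitting of 0).  On every time interval
  on which sigma is constant, the increment of q is drift * dt + D * dW.\<close>
definition switching_solution ::
  "real \<Rightarrow> real \<Rightarrow> real \<Rightarrow> real \<Rightarrow> real \<Rightarrow> real \<Rightarrow> real \<Rightarrow>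
   (real \<Rightarrow> real) \<Rightarrow> (real \<Rightarrow> real) \<Rightarrow> (real \<Rightarrow> real) \<Rightarrow> bool" where
  "switching_solution m r b D0 D1 T \<epsilon> w q \<sigma> \<longleftrightarrow>
     q 0 = 0 \<and> continuous_on {0..T} q \<and>
     (\<forall>t\<in>{0..T}. \<sigma> t =
        (if \<exists>s\<in>{0..t}. q s = b \<and> (\<forall>u\<in>{s..t}. q u \<noteq> 0) then r / \<epsilon> else 0)) \<and>
     (\<forall>t>T. \<sigma> t = 0) \<and>
     (\<forall>s t. 0 \<le> s \<and> s \<le> t \<and> t \<le> T \<and> (\<forall>u\<in>{s..<t}. \<sigma> u = 0) \<longrightarrow>
        q t - q s = m * (t - s) + D0 * (w t - w s)) \<and>
     (\<forall>s t. 0 \<le> s \<and> s \<le> t \<and> t \<le> T \<and> (\<forall>u\<in>{s..<t}. \<sigma> u = r / \<epsilon>) \<longrightarrow>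
        q t - q s = - (r / \<epsilon>) * (t - s) + D1 * (w t - w s))"

definition hit_time :: "(real \<Rightarrow> real) \<Rightarrow> real \<Rightarrow> real" where
  "hit_time e a = Inf {t. 0 < t \<and> e t = a}"

definition count_hits :: "(real \<Rightarrow> real) \<Rightarrow> real \<Rightarrow> real \<Rightarrow> nat" where
  "count_hits e b T = card {k::nat. 1 \<le> k \<and> hit_time e (real k * b) \<le> T}"

end

theory Submission
  imports Defs
begin

text \<open>Each burst \<open>[s, t)\<close> of \<open>\<sigma>\<^sup>\<epsilon>\<close> carries mass \<open>(r / \<epsilon>) (t - s) = b + D1 (W t - W s)\<close>, so its
  length is \<open>O(\<epsilon>)\<close> and its mass tends to \<open>b\<close>. Between bursts \<open>q\<^sup>\<epsilon>\<close> moves like \<open>E\<close>, so the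
  \<open>k\<close>-th burst starts when \<open>E\<close> reaches a level that tends to \<open>k b\<close>. Almost surely \<open>E\<close> exceeds
  \<open>k b\<close> immediately after hitting it, because the maximum of \<open>E\<close> over an interval has no atoms;
  hence the burst converges to \<open>\<tau>\<^sub>k\<close> and the pairings converge almost surely.

  For the \<open>L\<^sup>2\<close> bound, the paths of \<open>W\<close> are Hoelder continuous of order \<open>1/3\<close> with a random
  constant \<open>K\<close> such that \<open>K\<^sup>8\<close> is integrable. Consecutive bursts are separated by an oscillation
  \<open>b\<close> of \<open>E\<close>, so there are \<open>O(K\<^sup>3)\<close> of them, each of mass \<open>O(K)\<close>, uniformly in \<open>\<epsilon>\<close>.\<close>

section \<open>Hoelder continuity from dyadic increments\<close>

definition hoelder_on :: "real \<Rightarrow> real \<Rightarrow> 'a::metric_space set \<Rightarrow> ('a \<Rightarrow> 'b::metric_space) \<Rightarrow> bool" where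
  "hoelder_on \<gamma> C S f \<longleftrightarrow> (\<forall>x\<in>S. \<forall>y\<in>S. dist (f x) (f y) \<le> C * dist x y powr \<gamma>)"

lemma hoelder_onD: "hoelder_on \<gamma> C S f \<Longrightarrow> x \<in> S \<Longrightarrow> y \<in> S \<Longrightarrow> dist (f x) (f y) \<le> C * dist x y powr \<gamma>"
  by (simp add: hoelder_on_def)

lemma hoelder_on_subset: "hoelder_on \<gamma> C S f \<Longrightarrow> S' \<subseteq> S \<Longrightarrow> hoelder_on \<gamma> C S' f"
  by (auto simp: hoelder_on_def)

lemma hoelder_on_mono:
  assumes "hoelder_on \<gamma> C S f" "C \<le> C'"
  shows "hoelder_on \<gamma> C' S f"
  using assms unfolding hoelder_on_def by (meson mult_right_mono order_trans powr_ge_zero)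

lemma hoelder_on_rescale:
  fixes f :: "real \<Rightarrow> 'a::metric_space"
  assumes "0 < L" "hoelder_on \<gamma> C {0..1} (\<lambda>t. f (L * t))"
  shows "hoelder_on \<gamma> (C / L powr \<gamma>) {0..L} f"
  unfolding hoelder_on_def
proof (intro ballI)
  fix x y assume "x \<in> {0..L}" "y \<in> {0..L}"
  then have "x / L \<in> {0..1}" "y / L \<in> {0..1}"
    using assms(1) by auto
  then have "dist (f (L * (x / L))) (f (L * (y / L))) \<le> C * dist (x / L) (y / L) powr \<gamma>"
    by (rule hoelder_onD[OF assms(2)])
  moreover have "dist (x / L) (y / L) powr \<gamma> = dist x y powr \<gamma> / L powr \<gamma>"
    using assms(1) by (simp add: dist_real_def powr_divide flip: diff_divide_distrib)
  ultimately show "dist (f x) (f y) \<le> C / L powr \<gamma> * dist x y powr \<gamma>"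
    using assms(1) by simp
qed

lemma dyadic_bracket:
  fixes d :: real
  assumes "0 < d" "d \<le> 1"
  obtains n where "1 / 2 ^ Suc n < d" "d \<le> 1 / 2 ^ n"
proof (rule that)
  let ?P = "\<lambda>n. 1 / 2 ^ Suc n < d"
  obtain n where "(1 / 2) ^ n < d"
    using real_arch_pow_inv[OF assms(1), of "1 / 2"] by auto
  moreover have "1 / 2 ^ Suc n \<le> (1 / (2::real)) ^ n"
    by (simp add: field_simps)
  ultimately have "?P n"
    by simp
  then show "?P (LEAST n. ?P n)"
    by (rule LeastI)
  show "d \<le> 1 / 2 ^ (LEAST n. ?P n)"
  proof (cases "LEAST n. ?P n")
    case (Suc k)
    then have "\<not> ?P k"
      using not_less_Least[of k ?P] by simp
    then show ?thesis
      using Suc by simp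
  qed (use assms(2) in simp)
qed

locale dyadic_increments =
  fixes f :: "real \<Rightarrow> 'a::metric_space" and \<rho> K :: real
  assumes f_continuous: "continuous_on {0..1} f"
    and \<rho>_bounds: "0 \<le> \<rho>" "\<rho> < 1"
    and increment_le: "j < 2 ^ n \<Longrightarrow> dist (f ((real j + 1) / 2 ^ n)) (f (real j / 2 ^ n)) \<le> K * \<rho> ^ n"
begin

definition dyadic_index :: "nat \<Rightarrow> real \<Rightarrow> nat" where
  "dyadic_index n z = nat \<lfloor>2 ^ n * z\<rfloor>"

definition dyadic_floor :: "nat \<Rightarrow> real \<Rightarrow> real" where
  "dyadic_floor n z = real (dyadic_index n z) / 2 ^ n"

lemma K_nonneg: "0 \<le> K"
  using order_trans[OF zero_le_dist increment_le[of 0 0]] by simp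

lemma dyadic_index_bounds:
  assumes "z \<in> {0..1}"
  shows "real (dyadic_index n z) \<le> 2 ^ n * z" "2 ^ n * z < real (dyadic_index n z) + 1"
    "dyadic_index n z \<le> 2 ^ n"
proof -
  show "real (dyadic_index n z) \<le> 2 ^ n * z" "2 ^ n * z < real (dyadic_index n z) + 1"
    using assms by (auto simp: dyadic_index_def)
  moreover have "2 ^ n * z \<le> 2 ^ n"
    using assms by simp
  ultimately have "real (dyadic_index n z) \<le> 2 ^ n"
    by linarith
  then show "dyadic_index n z \<le> 2 ^ n"
    by (metis of_nat_le_iff of_nat_numeral of_nat_power)
qed

lemma dyadic_floor_in_unit_interval: "z \<in> {0..1} \<Longrightarrow> dyadic_floor n z \<in> {0..1}"
  using dyadic_index_bounds(3)[of z n] by (auto simp: dyadic_floor_def divide_le_eq)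

lemma dyadic_floor_tendsto:
  assumes "z \<in> {0..1}"
  shows "(\<lambda>n. dyadic_floor n z) \<longlonglongrightarrow> z"
proof (rule tendsto_sandwich)
  have "z - (1 / 2) ^ n = (2 ^ n * z - 1) / 2 ^ n" for n
    by (simp add: power_one_over diff_divide_distrib)
  then have "z - (1 / 2) ^ n \<le> dyadic_floor n z" "dyadic_floor n z \<le> z" for n
    using dyadic_index_bounds(1,2)[OF assms, of n]
    by (auto simp: dyadic_floor_def divide_right_mono pos_divide_le_eq mult.commute)
  then show "\<forall>\<^sub>F n in sequentially. z - (1 / 2) ^ n \<le> dyadic_floor n z"
    "\<forall>\<^sub>F n in sequentially. dyadic_floor n z \<le> z"
    by simp_all
  have "(\<lambda>n. z - (1 / 2) ^ n) \<longlonglongrightarrow> z - 0"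
    by (intro tendsto_intros LIMSEQ_realpow_zero) auto
  then show "(\<lambda>n. z - (1 / 2) ^ n) \<longlonglongrightarrow> z"
    by simp
qed simp

lemma dist_at_adjacent_indices_le:
  assumes "j \<le> i" "i \<le> Suc j" "i \<le> 2 ^ n"
  shows "dist (f (real i / 2 ^ n)) (f (real j / 2 ^ n)) \<le> K * \<rho> ^ n"
proof (cases "i = j")
  case True
  then show ?thesis
    using K_nonneg \<rho>_bounds by simp
next
  case False
  then have "i = Suc j"
    using assms by simp
  then show ?thesis
    using increment_le[of j n] assms(3) by (simp add: add.commute)
qed

lemma dist_dyadic_floor_Suc_le:
  assumes "z \<in> {0..1}"
  shows "dist (f (dyadic_floor (Suc n) z)) (f (dyadic_floor n z)) \<le> K * \<rho> ^ Suc n"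
proof -
  have "real (2 * dyadic_index n z) < real (dyadic_index (Suc n) z) + 1"
    "real (dyadic_index (Suc n) z) < real (2 * dyadic_index n z + 2)"
    using dyadic_index_bounds(1,2)[OF assms, of n] dyadic_index_bounds(1,2)[OF assms, of "Suc n"]
    by auto
  then have "2 * dyadic_index n z \<le> dyadic_index (Suc n) z"
    "dyadic_index (Suc n) z \<le> Suc (2 * dyadic_index n z)"
    by linarith+
  moreover have "dyadic_floor n z = real (2 * dyadic_index n z) / 2 ^ Suc n"
    by (simp add: dyadic_floor_def)
  ultimately show ?thesis
    using dist_at_adjacent_indices_le dyadic_index_bounds(3)[OF assms, of "Suc n"]
    by (metis dyadic_floor_def)
qed

lemma dist_dyadic_floor_le:
  assumes z_in: "z \<in> {0..1}"
  shows "dist (f z) (f (dyadic_floor n z)) \<le> K * \<rho> ^ Suc n / (1 - \<rho>)"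
proof -
  have "dist (f (dyadic_floor (n + k) z)) (f (dyadic_floor n z))
      \<le> K * (\<rho> ^ Suc n - \<rho> ^ Suc (n + k)) / (1 - \<rho>)" for k
  proof (induction k)
    case (Suc k)
    have "K * (\<rho> ^ Suc n - \<rho> ^ Suc (n + k)) / (1 - \<rho>) + K * \<rho> ^ Suc (n + k)
        = K * (\<rho> ^ Suc n - \<rho> ^ Suc (n + Suc k)) / (1 - \<rho>)"
      using \<rho>_bounds(2) by (simp add: field_simps)
    then show ?case
      using dist_dyadic_floor_Suc_le[OF z_in, of "n + k"] Suc
        dist_triangle[of "f (dyadic_floor (n + Suc k) z)" "f (dyadic_floor n z)"
            "f (dyadic_floor (n + k) z)"]
      by simp
  qed simp
  moreover have "K * (\<rho> ^ Suc n - \<rho> ^ Suc (n + k)) / (1 - \<rho>) \<le> K * \<rho> ^ Suc n / (1 - \<rho>)" for k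
    using \<rho>_bounds K_nonneg by (intro divide_right_mono mult_left_mono) auto
  ultimately have "dist (f (dyadic_floor (n + k) z)) (f (dyadic_floor n z))
      \<le> K * \<rho> ^ Suc n / (1 - \<rho>)" for k
    by (meson order_trans)
  moreover have "(\<lambda>k. f (dyadic_floor (n + k) z)) \<longlonglongrightarrow> f z"
    using LIMSEQ_ignore_initial_segment[OF dyadic_floor_tendsto[OF z_in], of n] z_in
        dyadic_floor_in_unit_interval[OF z_in]
    by (intro continuous_on_tendsto_compose[OF f_continuous]) (auto simp: add.commute)
  ultimately show ?thesis
    by (intro tendsto_le[OF _ tendsto_const tendsto_dist[OF _ tendsto_const]]) auto
qed

lemma dist_dyadic_floors_le:
  assumes "x \<in> {0..1}" "y \<in> {0..1}" "x \<le> y" "y - x \<le> 1 / 2 ^ n"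
  shows "dist (f (dyadic_floor n y)) (f (dyadic_floor n x)) \<le> K * \<rho> ^ n"
  unfolding dyadic_floor_def
proof (rule dist_at_adjacent_indices_le)
  have "2 ^ n * x \<le> 2 ^ n * y"
    using assms(3) by simp
  then show "dyadic_index n x \<le> dyadic_index n y"
    unfolding dyadic_index_def by (intro nat_mono floor_mono)
  have "2 ^ n * y \<le> 2 ^ n * x + 1"
    using assms(4) by (simp add: field_simps)
  then have "real (dyadic_index n y) < real (dyadic_index n x) + 2"
    using dyadic_index_bounds(1)[OF assms(2), of n] dyadic_index_bounds(2)[OF assms(1), of n]
    by linarith
  then show "dyadic_index n y \<le> Suc (dyadic_index n x)"
    by linarith
qed (rule dyadic_index_bounds(3)[OF assms(2)])

lemma chaining_modulus:
  assumes "x \<in> {0..1}" "y \<in> {0..1}" "\<bar>x - y\<bar> \<le> 1 / 2 ^ n"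
  shows "dist (f x) (f y) \<le> K * ((1 + \<rho>) / (1 - \<rho>)) * \<rho> ^ n"
proof -
  have wlog: "dist (f y) (f x) \<le> K * ((1 + \<rho>) / (1 - \<rho>)) * \<rho> ^ n"
    if "x \<in> {0..1}" "y \<in> {0..1}" "x \<le> y" "y - x \<le> 1 / 2 ^ n" for x y
  proof -
    have "dist (f y) (f x)
        \<le> K * \<rho> ^ Suc n / (1 - \<rho>) + (K * \<rho> ^ n + K * \<rho> ^ Suc n / (1 - \<rho>))"
      using dist_dyadic_floor_le[OF that(2), of n] dist_dyadic_floor_le[OF that(1), of n]
        dist_dyadic_floors_le[OF that]
        dist_triangle[of "f y" "f x" "f (dyadic_floor n y)"]
        dist_triangle[of "f (dyadic_floor n y)" "f x" "f (dyadic_floor n x)"]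
      by (simp add: dist_commute)
    also have "\<dots> = K * (1 + 2 * \<rho> / (1 - \<rho>)) * \<rho> ^ n"
      by (simp add: algebra_simps)
    also have "1 + 2 * \<rho> / (1 - \<rho>) = (1 + \<rho>) / (1 - \<rho>)"
      using \<rho>_bounds(2) by (simp add: field_simps)
    finally show ?thesis .
  qed
  show ?thesis
  proof (cases "x \<le> y")
    case True
    then show ?thesis
      using wlog[of x y] assms by (simp add: dist_commute)
  next
    case False
    then show ?thesis
      using wlog[of y x] assms by simp
  qed
qed

lemma hoelder_on_unit_interval:
  assumes \<gamma>_nonneg: "0 \<le> \<gamma>" and \<rho>_eq: "\<rho> = 2 powr - \<gamma>"
  shows "hoelder_on \<gamma> (K * ((1 + \<rho>) / (1 - \<rho>)) * 2 powr \<gamma>) {0..1} f"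
  unfolding hoelder_on_def
proof (intro ballI)
  fix x y :: real assume xy_in: "x \<in> {0..1}" "y \<in> {0..1}"
  show "dist (f x) (f y) \<le> K * ((1 + \<rho>) / (1 - \<rho>)) * 2 powr \<gamma> * dist x y powr \<gamma>"
  proof (cases "x = y")
    case False
    then have "0 < dist x y" "dist x y \<le> 1"
      using xy_in by (auto simp: dist_real_def)
    then obtain n where bracket: "1 / 2 ^ Suc n < dist x y" "dist x y \<le> 1 / 2 ^ n"
      by (rule dyadic_bracket)
    have "\<rho> ^ n = (1 / 2 ^ n) powr \<gamma>"
      unfolding \<rho>_eq by (simp add: powr_minus powr_divide powr_realpow[symmetric] powr_powr
          mult.commute divide_simps)
    also have "\<dots> \<le> (2 * dist x y) powr \<gamma>"
      using bracket(1) \<gamma>_nonneg by (intro powr_mono2) (auto simp: field_simps)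
    also have "\<dots> = 2 powr \<gamma> * dist x y powr \<gamma>"
      by (simp add: powr_mult)
    finally have "K * ((1 + \<rho>) / (1 - \<rho>)) * \<rho> ^ n
        \<le> K * ((1 + \<rho>) / (1 - \<rho>)) * (2 powr \<gamma> * dist x y powr \<gamma>)"
      using K_nonneg \<rho>_bounds by (intro mult_left_mono) auto
    moreover have "dist (f x) (f y) \<le> K * ((1 + \<rho>) / (1 - \<rho>)) * \<rho> ^ n"
      using bracket(2) xy_in by (intro chaining_modulus) (auto simp: dist_real_def)
    ultimately show ?thesis
      by (simp add: mult.assoc)
  qed simp
qed

end

locale kolmogorov_chentsov =
  fixes M :: "'a measure" and X :: "real \<Rightarrow> 'a \<Rightarrow> real" and p :: nat and C \<beta> \<gamma> :: real
  assumes X_measurable: "t \<in> {0..1} \<Longrightarrow> X t \<in> borel_measurable M"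
    and X_continuous: "\<omega> \<in> space M \<Longrightarrow> continuous_on {0..1} (\<lambda>t. X t \<omega>)"
    and moment_le: "0 \<le> s \<Longrightarrow> s < t \<Longrightarrow> t \<le> 1 \<Longrightarrow>
      (\<integral>\<^sup>+\<omega>. ennreal (\<bar>X t \<omega> - X s \<omega>\<bar> ^ p) \<partial>M) \<le> ennreal (C * (t - s) powr (1 + \<beta>))"
    and C_nonneg: "0 \<le> C" and p_pos: "0 < p" and \<gamma>_pos: "0 < \<gamma>" and exponent_less: "\<gamma> * real p < \<beta>"
begin

definition \<rho> :: real where
  "\<rho> = 2 powr - \<gamma>"

lemma \<rho>_bounds: "0 < \<rho>" "\<rho> < 1"
  using \<gamma>_pos by (simp_all add: \<rho>_def powr_less_one)

definition scaled_increment :: "nat \<Rightarrow> nat \<Rightarrow> 'a \<Rightarrow> real" where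
  "scaled_increment n j \<omega> = \<bar>X ((real j + 1) / 2 ^ n) \<omega> - X (real j / 2 ^ n) \<omega>\<bar> / \<rho> ^ n"

definition dyadic_moment :: "'a \<Rightarrow> ennreal" where
  "dyadic_moment \<omega> = (\<Sum>n. \<Sum>j<2 ^ n. ennreal (scaled_increment n j \<omega> ^ p))"

lemma dyadic_points_in_unit_interval:
  assumes "j < 2 ^ n"
  shows "(real j + 1) / 2 ^ n \<in> {0..1}" "real j / 2 ^ n \<in> {0..1}"
proof -
  have "real j + 1 \<le> 2 ^ n"
    using assms by (metis Suc_le_eq of_nat_Suc add.commute of_nat_le_iff
        of_nat_numeral of_nat_power)
  then show "(real j + 1) / 2 ^ n \<in> {0..1}" "real j / 2 ^ n \<in> {0..1}"
    using assms by (auto simp: divide_le_eq less_imp_le)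
qed

lemma scaled_increment_measurable: "j < 2 ^ n \<Longrightarrow> scaled_increment n j \<in> borel_measurable M"
  unfolding scaled_increment_def[abs_def]
  by (intro borel_measurable_divide borel_measurable_abs borel_measurable_diff X_measurable
      dyadic_points_in_unit_interval borel_measurable_const)

lemma dyadic_moment_measurable: "dyadic_moment \<in> borel_measurable M"
proof -
  have [measurable]: "(\<lambda>\<omega>. \<Sum>j<2 ^ n. ennreal (scaled_increment n j \<omega> ^ p)) \<in> borel_measurable M"
    for n
    by (intro borel_measurable_sum measurable_compose[OF _ measurable_ennreal]
        borel_measurable_power scaled_increment_measurable) simp
  show ?thesis
    unfolding dyadic_moment_def[abs_def] by measurable
qed

lemma scaled_increment_le_dyadic_moment:
  assumes "j < 2 ^ n"
  shows "ennreal (scaled_increment n j \<omega> ^ p) \<le> dyadic_moment \<omega>"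
proof -
  have "ennreal (scaled_increment n j \<omega> ^ p) \<le> (\<Sum>j<2 ^ n. ennreal (scaled_increment n j \<omega> ^ p))"
    using assms by (intro member_le_sum) auto
  also have "\<dots> \<le> dyadic_moment \<omega>"
    using sum_le_suminf[of "\<lambda>n. \<Sum>j<2 ^ n. ennreal (scaled_increment n j \<omega> ^ p)" "{n}"]
    by (simp add: dyadic_moment_def)
  finally show ?thesis .
qed

lemma nn_integral_scaled_increment_le:
  assumes j_less: "j < 2 ^ n"
  shows "(\<integral>\<^sup>+\<omega>. ennreal (scaled_increment n j \<omega> ^ p) \<partial>M)
      \<le> ennreal (C / \<rho> ^ (n * p) * (1 / 2 ^ n) powr (1 + \<beta>))"
proof -
  let ?s = "real j / 2 ^ n" and ?t = "(real j + 1) / 2 ^ n"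
  have diff: "?t - ?s = 1 / 2 ^ n"
    by (simp add: diff_divide_distrib[symmetric])
  have measurable: "(\<lambda>\<omega>. ennreal (\<bar>X ?t \<omega> - X ?s \<omega>\<bar> ^ p)) \<in> borel_measurable M"
    by (intro measurable_compose[OF _ measurable_ennreal] borel_measurable_power
        borel_measurable_abs borel_measurable_diff X_measurable dyadic_points_in_unit_interval[OF j_less])
  have "(\<integral>\<^sup>+\<omega>. ennreal (scaled_increment n j \<omega> ^ p) \<partial>M)
      = (\<integral>\<^sup>+\<omega>. ennreal (1 / \<rho> ^ (n * p)) * ennreal (\<bar>X ?t \<omega> - X ?s \<omega>\<bar> ^ p) \<partial>M)"
    using \<rho>_bounds by (simp add: scaled_increment_def power_divide power_mult flip: ennreal_mult)
  also have "\<dots> = ennreal (1 / \<rho> ^ (n * p)) * (\<integral>\<^sup>+\<omega>. ennreal (\<bar>X ?t \<omega> - X ?s \<omega>\<bar> ^ p) \<partial>M)"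
    using measurable by (rule nn_integral_cmult)
  also have "\<dots> \<le> ennreal (1 / \<rho> ^ (n * p)) * ennreal (C * (?t - ?s) powr (1 + \<beta>))"
    using dyadic_points_in_unit_interval[OF j_less]
    by (intro mult_left_mono moment_le) (auto simp: divide_strict_right_mono)
  also have "\<dots> = ennreal (C / \<rho> ^ (n * p) * (1 / 2 ^ n) powr (1 + \<beta>))"
    using C_nonneg \<rho>_bounds by (simp add: diff flip: ennreal_mult)
  finally show ?thesis .
qed

lemma dyadic_level_moment_eq:
  "2 ^ n * (C / \<rho> ^ (n * p) * (1 / 2 ^ n) powr (1 + \<beta>)) = C * (2 powr (\<gamma> * real p - \<beta>)) ^ n"
proof -
  have "2 ^ n * (C / \<rho> ^ (n * p) * (1 / 2 ^ n) powr (1 + \<beta>))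
      = C * (2 powr real n / 2 powr (- \<gamma> * (real n * real p)) * 2 powr (- real n * (1 + \<beta>)))"
    by (simp add: \<rho>_def powr_realpow[symmetric] powr_powr powr_minus_divide[symmetric])
  also have "\<dots> = C * 2 powr (real n - (- \<gamma> * (real n * real p)) + - real n * (1 + \<beta>))"
    by (simp only: powr_add powr_diff)
  also have "real n - (- \<gamma> * (real n * real p)) + - real n * (1 + \<beta>) = (\<gamma> * real p - \<beta>) * real n"
    by (simp add: algebra_simps)
  finally show ?thesis
    by (simp add: powr_realpow[symmetric] powr_powr)
qed

lemma nn_integral_dyadic_moment_finite: "(\<integral>\<^sup>+\<omega>. dyadic_moment \<omega> \<partial>M) < \<infinity>"
proof -
  let ?\<theta> = "2 powr (\<gamma> * real p - \<beta>)"
  have measurable: "(\<lambda>\<omega>. ennreal (scaled_increment n j \<omega> ^ p)) \<in> borel_measurable M"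
    if "j < 2 ^ n" for n j
    using scaled_increment_measurable[OF that] by measurable
  have "(\<integral>\<^sup>+\<omega>. (\<Sum>j<2 ^ n. ennreal (scaled_increment n j \<omega> ^ p)) \<partial>M) \<le> ennreal (C * ?\<theta> ^ n)" for n
  proof -
    have "(\<integral>\<^sup>+\<omega>. (\<Sum>j<2 ^ n. ennreal (scaled_increment n j \<omega> ^ p)) \<partial>M)
        = (\<Sum>j<2 ^ n. \<integral>\<^sup>+\<omega>. ennreal (scaled_increment n j \<omega> ^ p) \<partial>M)"
      using measurable by (intro nn_integral_sum) simp
    also have "\<dots> \<le> (\<Sum>j<(2::nat) ^ n. ennreal (C / \<rho> ^ (n * p) * (1 / 2 ^ n) powr (1 + \<beta>)))"
      by (intro sum_mono nn_integral_scaled_increment_le) simp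
    also have "\<dots> = ennreal (2 ^ n * (C / \<rho> ^ (n * p) * (1 / 2 ^ n) powr (1 + \<beta>)))"
      using C_nonneg \<rho>_bounds by (subst sum_ennreal) auto
    finally show ?thesis
      by (simp only: dyadic_level_moment_eq)
  qed
  then have "(\<integral>\<^sup>+\<omega>. dyadic_moment \<omega> \<partial>M) \<le> (\<Sum>n. ennreal (C * ?\<theta> ^ n))"
    unfolding dyadic_moment_def using measurable
    by (subst nn_integral_suminf) (auto intro!: suminf_le)
  also have "\<dots> < \<infinity>"
    using C_nonneg exponent_less
    by (subst suminf_ennreal2) (auto intro!: summable_mult summable_geometric simp: powr_less_one)
  finally show ?thesis .
qed

lemma increment_le_root_dyadic_moment:
  assumes "j < 2 ^ n" "dyadic_moment \<omega> < \<infinity>"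
  shows "\<bar>X ((real j + 1) / 2 ^ n) \<omega> - X (real j / 2 ^ n) \<omega>\<bar>
      \<le> root p (enn2real (dyadic_moment \<omega>)) * \<rho> ^ n"
proof -
  have "scaled_increment n j \<omega> ^ p \<le> enn2real (dyadic_moment \<omega>)"
    using scaled_increment_le_dyadic_moment[OF assms(1), of \<omega>] assms(2)
    by (metis enn2real_nonneg enn2real_ennreal ennreal_enn2real ennreal_le_iff infinity_ennreal_def)
  then have "root p (scaled_increment n j \<omega> ^ p) \<le> root p (enn2real (dyadic_moment \<omega>))"
    using p_pos by (rule real_root_le_mono[rotated])
  then show ?thesis
    using p_pos \<rho>_bounds by (simp add: scaled_increment_def real_root_power_cancel pos_divide_le_eq)
qed

theorem paths_hoelder:
  obtains K where "K \<in> borel_measurable M" "\<And>\<omega>. 0 \<le> K \<omega>" "(\<integral>\<^sup>+\<omega>. ennreal (K \<omega> ^ p) \<partial>M) < \<infinity>"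
    "AE \<omega> in M. hoelder_on \<gamma> (K \<omega>) {0..1} (\<lambda>t. X t \<omega>)"
proof
  define c where "c = (1 + \<rho>) / (1 - \<rho>) * 2 powr \<gamma>"
  have c_nonneg: "0 \<le> c"
    using \<rho>_bounds by (simp add: c_def)
  define K where "K \<omega> = c * root p (enn2real (dyadic_moment \<omega>))" for \<omega>
  note [measurable] = dyadic_moment_measurable
  show "K \<in> borel_measurable M"
    unfolding K_def[abs_def] by measurable
  show "0 \<le> K \<omega>" for \<omega>
    using c_nonneg p_pos by (simp add: K_def real_root_ge_zero)
  have "(\<integral>\<^sup>+\<omega>. ennreal (K \<omega> ^ p) \<partial>M) \<le> (\<integral>\<^sup>+\<omega>. ennreal (c ^ p) * dyadic_moment \<omega> \<partial>M)"
    using c_nonneg p_pos by (intro nn_integral_mono)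
      (auto simp: K_def power_mult_distrib ennreal_mult ennreal_enn2real_if intro!: mult_left_mono)
  also have "\<dots> = ennreal (c ^ p) * (\<integral>\<^sup>+\<omega>. dyadic_moment \<omega> \<partial>M)"
    by (rule nn_integral_cmult) measurable
  also have "\<dots> < \<infinity>"
    using nn_integral_dyadic_moment_finite by (simp add: ennreal_mult_less_top)
  finally show "(\<integral>\<^sup>+\<omega>. ennreal (K \<omega> ^ p) \<partial>M) < \<infinity>" .
  have "AE \<omega> in M. dyadic_moment \<omega> \<noteq> \<infinity>"
    using nn_integral_dyadic_moment_finite dyadic_moment_measurable
    by (intro nn_integral_PInf_AE) auto
  then show "AE \<omega> in M. hoelder_on \<gamma> (K \<omega>) {0..1} (\<lambda>t. X t \<omega>)"
    using AE_space
  proof eventually_elim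
    case (elim \<omega>)
    interpret dyadic_increments "\<lambda>t. X t \<omega>" \<rho> "root p (enn2real (dyadic_moment \<omega>))"
      using elim X_continuous \<rho>_bounds increment_le_root_dyadic_moment
      by unfold_locales (auto simp: dist_real_def less_top)
    show ?case
      using hoelder_on_unit_interval[of \<gamma>] \<gamma>_pos by (simp add: K_def c_def \<rho>_def mult_ac)
  qed
qed

end

section \<open>First hitting times\<close>

text \<open>Truncated at \<open>T\<close>: the value is \<open>T\<close> if \<open>a\<close> is not reached any more.\<close>

definition first_hit :: "(real \<Rightarrow> real) \<Rightarrow> real \<Rightarrow> real \<Rightarrow> real \<Rightarrow> real" where
  "first_hit f T u a = Inf (insert T {t \<in> {u..T}. f t = a})"

lemma
  assumes "continuous_on {u..T} f" "u \<le> T"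
  shows first_hit_ge: "u \<le> first_hit f T u a"
    and first_hit_le: "first_hit f T u a \<le> T"
    and at_first_hit: "first_hit f T u a < T \<Longrightarrow> f (first_hit f T u a) = a"
    and before_first_hit: "u \<le> x \<Longrightarrow> x < first_hit f T u a \<Longrightarrow> f x \<noteq> a"
proof -
  let ?S = "insert T {t \<in> {u..T}. f t = a}"
  have "closed {t \<in> {u..T}. f t = a}"
    using continuous_closed_preimage[OF assms(1), of "{a}"]
    by (simp add: vimage_def Int_def)
  then have closed: "closed ?S"
    by (rule closed_insert)
  have bdd: "bdd_below ?S"
    using assms(2) by (auto intro!: bdd_belowI[of _ u])
  have attained: "first_hit f T u a \<in> ?S"
    unfolding first_hit_def using closed bdd by (intro closed_contains_Inf) auto
  then show "u \<le> first_hit f T u a" and le_end: "first_hit f T u a \<le> T"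
    and "first_hit f T u a < T \<Longrightarrow> f (first_hit f T u a) = a"
    using assms(2) by auto
  show "f x \<noteq> a" if "u \<le> x" "x < first_hit f T u a"
    using that le_end cInf_lower[OF _ bdd, of x] by (auto simp: first_hit_def)
qed

lemma first_hit_eqI:
  assumes "u \<le> x" "x \<le> T" "x < T \<Longrightarrow> f x = a" "\<And>y. u \<le> y \<Longrightarrow> y < x \<Longrightarrow> f y \<noteq> a"
  shows "first_hit f T u a = x"
  unfolding first_hit_def
proof (rule cInf_eq_minimum)
  show "x \<in> insert T {t \<in> {u..T}. f t = a}"
    using assms(1-3) by (cases "x = T") auto
  show "x \<le> y" if "y \<in> insert T {t \<in> {u..T}. f t = a}" for y
    using that assms(2) assms(4)[of y] by force
qed

lemma eventually_less_first_hit: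
  assumes f_continuous: "continuous_on {0..T} f"
    and below: "0 \<le> x" "x \<le> T" "\<And>y. y \<in> {0..x} \<Longrightarrow> f y < a"
    and v_in: "eventually (\<lambda>z. v z \<in> {0..T}) F" and c_tendsto: "(c \<longlongrightarrow> a) F"
  shows "eventually (\<lambda>z. first_hit f T (v z) (c z) = T \<or> x < first_hit f T (v z) (c z)) F"
proof -
  obtain y where maximum: "y \<in> {0..x}" "\<And>z. z \<in> {0..x} \<Longrightarrow> f z \<le> f y"
    using continuous_attains_sup[of "{0..x}" f] below(1,2)
      continuous_on_subset[OF f_continuous, of "{0..x}"] by auto
  have "eventually (\<lambda>z. f y < c z) F"
    using order_tendstoD(1)[OF c_tendsto] below(3)[OF maximum(1)] by blast
  with v_in show ?thesis
  proof eventually_elim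
    case (elim z)
    let ?h = "first_hit f T (v z) (c z)"
    have cont: "continuous_on {v z..T} f"
      using elim(1) by (intro continuous_on_subset[OF f_continuous]) auto
    have "?h < T \<Longrightarrow> ?h \<le> x \<Longrightarrow> c z \<le> f y"
      using at_first_hit[OF cont, of "c z"] first_hit_ge[OF cont, of "c z"]
        maximum(2)[of ?h] elim(1) by auto
    then show ?case
      using first_hit_le[OF cont, of "c z"] elim by force
  qed
qed

lemma less_before_first_hit:
  assumes segment: "continuous_on {u..T} f" "u \<le> T" and start_less: "f u < a"
    and before: "u \<le> x" "x < first_hit f T u a"
  shows "f x < a"
proof (rule ccontr)
  assume "\<not> f x < a"
  moreover have "continuous_on {u..x} f"
    using before first_hit_le[OF segment, of a] by (intro continuous_on_subset[OF segment(1)]) auto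
  ultimately obtain y where "u \<le> y" "y \<le> x" "f y = a"
    using IVT'[of f u a x] start_less before(1) by auto
  then show False
    using before_first_hit[OF segment, of y a] before(2) by simp
qed

lemma eventually_first_hit_le:
  assumes f_continuous: "continuous_on {0..T} f"
    and v_tendsto: "(v \<longlongrightarrow> u) F" and v_in: "eventually (\<lambda>z. v z \<in> {0..T}) F"
    and c_tendsto: "(c \<longlongrightarrow> a) F"
    and start: "u \<in> {0..T}" "f u < a" and above: "u < y" "y \<le> T" "a < f y"
  shows "eventually (\<lambda>z. first_hit f T (v z) (c z) \<le> y) F"
proof -
  have "((\<lambda>z. f (v z)) \<longlongrightarrow> f u) F"
    using start(1) v_tendsto v_in by (intro continuous_on_tendsto_compose[OF f_continuous])
  from tendsto_diff[OF this c_tendsto] have "eventually (\<lambda>z. f (v z) - c z < 0) F"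
    using start(2) by (intro order_tendstoD(2)) auto
  moreover have "eventually (\<lambda>z. c z < f y) F" "eventually (\<lambda>z. v z < y) F"
    using c_tendsto v_tendsto above by (auto intro: order_tendstoD(2))
  ultimately show ?thesis
    using v_in
  proof eventually_elim
    case (elim z)
    have cont: "continuous_on {v z..T} f"
      using elim(4) by (intro continuous_on_subset[OF f_continuous]) auto
    then have "continuous_on {v z..y} f"
      by (rule continuous_on_subset) (use above(2) in auto)
    then obtain t where "v z \<le> t" "t \<le> y" "f t = c z"
      using IVT'[of f "v z" "c z" y] elim by auto
    then show ?case
      using before_first_hit[OF cont, of t "c z"] elim(4) by force
  qed
qed

lemma eventually_first_hit_le_end:
  assumes f_continuous: "continuous_on {0..T} f" and v_in: "eventually (\<lambda>z. v z \<in> {0..T}) F"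
  shows "eventually (\<lambda>z. first_hit f T (v z) (c z) \<le> T) F"
  using v_in
proof eventually_elim
  case (elim z)
  then show ?case
    by (intro first_hit_le continuous_on_subset[OF f_continuous]) auto
qed

lemma first_hit_tendsto:
  assumes f_continuous: "continuous_on {0..T} f" and f_0_less: "f 0 < a" and T_nonneg: "0 \<le> T"
    and v_tendsto: "(v \<longlongrightarrow> u) F" and v_in: "eventually (\<lambda>z. v z \<in> {0..T}) F"
    and c_tendsto: "(c \<longlongrightarrow> a) F"
    and start: "0 \<le> u" "u < first_hit f T 0 a"
    and crossing: "\<And>x. first_hit f T 0 a < x \<Longrightarrow> x \<le> T \<Longrightarrow> \<exists>y\<in>{first_hit f T 0 a<..<x}. a < f y"
  shows "((\<lambda>z. first_hit f T (v z) (c z)) \<longlongrightarrow> first_hit f T 0 a) F"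
proof (rule order_tendstoI)
  let ?h = "first_hit f T 0 a"
  have h_le: "?h \<le> T"
    using f_continuous T_nonneg by (rule first_hit_le)
  note below = less_before_first_hit[OF f_continuous T_nonneg f_0_less]
  show "eventually (\<lambda>z. x < first_hit f T (v z) (c z)) F" if bound: "x < ?h" for x
  proof -
    have "eventually (\<lambda>z. first_hit f T (v z) (c z) = T \<or> max 0 x < first_hit f T (v z) (c z)) F"
      using bound h_le start below
      by (intro eventually_less_first_hit[OF f_continuous _ _ _ v_in c_tendsto]) auto
    then show ?thesis
      by eventually_elim (use bound h_le in auto)
  qed
  show "eventually (\<lambda>z. first_hit f T (v z) (c z) < x) F" if bound: "?h < x" for x
  proof (cases "T < x")
    case True
    show ?thesis
      using eventually_first_hit_le_end[OF f_continuous v_in, of c]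
      by eventually_elim (use True in simp)
  next
    case False
    then obtain y where overshoot: "?h < y" "y < x" "a < f y"
      using crossing[OF bound] by auto
    have "eventually (\<lambda>z. first_hit f T (v z) (c z) \<le> y) F"
      using start overshoot h_le False below[OF start]
      by (intro eventually_first_hit_le[OF f_continuous v_tendsto v_in c_tendsto]) auto
    then show ?thesis
      by eventually_elim (use overshoot(2) in simp)
  qed
qed

lemma
  fixes e :: "real \<Rightarrow> real"
  assumes "continuous_on {0..} e" "e 0 = 0" "0 < a" "\<exists>t>0. e t = a"
  shows hit_time_pos: "0 < hit_time e a"
    and at_hit_time: "e (hit_time e a) = a"
    and before_hit_time: "0 \<le> x \<Longrightarrow> x < hit_time e a \<Longrightarrow> e x < a"
proof -
  let ?S = "{t. 0 < t \<and> e t = a}"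
  have S_eq: "?S = {t \<in> {0..}. e t \<in> {a}}"
    using assms(2,3) by (auto simp: less_le)
  have "closed ({0..} \<inter> e -` {a})"
    by (rule continuous_closed_preimage[OF assms(1)]) auto
  then have "closed ?S"
    unfolding S_eq by (simp add: vimage_def Int_def)
  moreover have bdd: "bdd_below ?S"
    by (auto intro!: bdd_belowI[of _ 0])
  ultimately have "hit_time e a \<in> ?S"
    unfolding hit_time_def using assms(4) by (intro closed_contains_Inf) auto
  then show "0 < hit_time e a" "e (hit_time e a) = a"
    by auto
  show "e x < a" if before: "0 \<le> x" "x < hit_time e a"
  proof (rule ccontr)
    assume "\<not> e x < a"
    moreover have "continuous_on {0..x} e"
      by (rule continuous_on_subset[OF assms(1)]) auto
    ultimately obtain y where attained: "0 \<le> y" "y \<le> x" "e y = a"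
      using IVT'[of e 0 a x] assms(2,3) before(1) by auto
    then have "hit_time e a \<le> y"
      unfolding hit_time_def using assms(2,3) by (intro cInf_lower bdd) (auto simp: less_le)
    then show False
      using before attained by simp
  qed
qed

lemma first_hit_eq_min_hit_time:
  assumes "continuous_on {0..} e" "e 0 = 0" "0 < a" "\<exists>t>0. e t = a" "0 \<le> T"
  shows "first_hit e T 0 a = min T (hit_time e a)"
proof (rule first_hit_eqI)
  show "0 \<le> min T (hit_time e a)"
    using hit_time_pos[OF assms(1-4)] assms(5) by simp
  show "e (min T (hit_time e a)) = a" if "min T (hit_time e a) < T"
    using at_hit_time[OF assms(1-4)] that by (simp add: min_def split: if_splits)
  show "e y \<noteq> a" if "0 \<le> y" "y < min T (hit_time e a)" for y
    using before_hit_time[OF assms(1-4), of y] that by simp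
qed simp

lemma ex_above_after_hit_time:
  assumes path: "continuous_on {0..} e" "e 0 = 0" "0 < a" "\<exists>t>0. e t = a"
    and sup_neq: "\<And>s t :: rat. 0 < s \<Longrightarrow> s < t \<Longrightarrow> (SUP x\<in>{real_of_rat s..real_of_rat t}. e x) \<noteq> a"
    and after: "hit_time e a < x"
  shows "\<exists>u\<in>{hit_time e a<..<x}. a < e u"
proof (rule ccontr)
  assume no_crossing: "\<not> ?thesis"
  obtain s where before_hit: "0 < real_of_rat s" "real_of_rat s < hit_time e a"
    using of_rat_dense[OF hit_time_pos[OF path]] by auto
  obtain t where after_hit: "hit_time e a < real_of_rat t" "real_of_rat t < x"
    using of_rat_dense[OF after] by auto
  have "e y \<le> a" if "real_of_rat s \<le> y" "y \<le> real_of_rat t" for y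
  proof (cases y "hit_time e a" rule: linorder_cases)
    case less
    then show ?thesis
      using before_hit_time[OF path, of y] before_hit that by simp
  next
    case greater
    then show ?thesis
      using no_crossing after_hit that by (force simp: not_less)
  qed (simp add: at_hit_time[OF path])
  then have "(SUP y\<in>{real_of_rat s..real_of_rat t}. e y) = a"
  proof (intro cSup_eq_maximum)
    show "a \<in> e ` {real_of_rat s..real_of_rat t}"
      using at_hit_time[OF path] before_hit after_hit
      by (intro image_eqI[of _ _ "hit_time e a"]) auto
  qed auto
  moreover have "0 < s" "s < t"
    using before_hit after_hit less_trans[OF before_hit(2) after_hit(1)]
    by (simp_all add: of_rat_less)
  ultimately show False
    using sup_neq by blast
qed

section \<open>Levels reached by the energy\<close>

definition energy :: "real \<Rightarrow> real \<Rightarrow> (real \<Rightarrow> real) \<Rightarrow> real \<Rightarrow> real" where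
  "energy m D w = (\<lambda>t. m * t + D * w t)"

lemma initial_segment_eq_Icc_card:
  fixes S :: "nat set"
  assumes "finite S" "\<And>k. k \<in> S \<Longrightarrow> 1 \<le> k" "\<And>j k. k \<in> S \<Longrightarrow> 1 \<le> j \<Longrightarrow> j \<le> k \<Longrightarrow> j \<in> S"
  shows "S = {1..card S}"
proof (cases "S = {}")
  case False
  have S_eq: "S = {1..Max S}"
  proof
    show "S \<subseteq> {1..Max S}"
      using assms(1,2) by auto
    show "{1..Max S} \<subseteq> S"
      using assms(3)[OF Max_in[OF assms(1) False]] by auto
  qed
  have "card S = Max S"
    by (subst S_eq) simp
  then show ?thesis
    using S_eq by simp
qed simp

locale energy_path =
  fixes E :: "real \<Rightarrow> real" and b T :: real
  assumes b_pos: "0 < b" and T_nonneg: "0 \<le> T"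
    and E_continuous: "continuous_on {0..} E" and E_0: "E 0 = 0"
    and levels_hit: "1 \<le> k \<Longrightarrow> \<exists>t>0. E t = real k * b"
begin

definition \<tau> :: "nat \<Rightarrow> real" where
  "\<tau> k = hit_time E (real k * b)"

lemma
  assumes "1 \<le> k"
  shows tau_pos: "0 < \<tau> k" and E_tau: "E (\<tau> k) = real k * b"
    and E_before_tau: "0 \<le> x \<Longrightarrow> x < \<tau> k \<Longrightarrow> E x < real k * b"
    and first_hit_eq_min_tau: "first_hit E T 0 (real k * b) = min T (\<tau> k)"
proof -
  have level_pos: "0 < real k * b"
    using assms b_pos by simp
  note hit = E_continuous E_0 level_pos levels_hit[OF assms]
  show "0 < \<tau> k" "E (\<tau> k) = real k * b" "first_hit E T 0 (real k * b) = min T (\<tau> k)"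
    "0 \<le> x \<Longrightarrow> x < \<tau> k \<Longrightarrow> E x < real k * b"
    unfolding \<tau>_def
    by (fact hit_time_pos[OF hit] at_hit_time[OF hit] before_hit_time[OF hit]
        first_hit_eq_min_hit_time[OF hit T_nonneg])+
qed

lemma tau_strict_mono:
  assumes "1 \<le> j" "j < k"
  shows "\<tau> j < \<tau> k"
proof (rule ccontr)
  assume "\<not> \<tau> j < \<tau> k"
  moreover have "E (\<tau> k) \<noteq> E (\<tau> j)"
    using assms b_pos by (simp add: E_tau)
  ultimately have "\<tau> k < \<tau> j"
    by (metis linorder_neqE_linordered_idom)
  then have "E (\<tau> k) < real j * b"
    using assms tau_pos[of k] by (intro E_before_tau) auto
  then show False
    using assms b_pos by (simp add: E_tau)
qed

lemma level_le:
  assumes "\<And>x. x \<in> {0..T} \<Longrightarrow> E x \<le> X" "1 \<le> k" "\<tau> k \<le> T"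
  shows "real k * b \<le> X"
  using assms tau_pos[of k] E_tau[of k] by (metis atLeastAtMost_iff less_imp_le)

lemma hits_eq_Icc: "{k. 1 \<le> k \<and> \<tau> k \<le> T} = {1..count_hits E b T}"
proof -
  let ?S = "{k. 1 \<le> k \<and> \<tau> k \<le> T}"
  obtain y where maximum: "\<And>x. x \<in> {0..T} \<Longrightarrow> E x \<le> E y"
    using continuous_attains_sup[of "{0..T}" E]
      continuous_on_subset[OF E_continuous, of "{0..T}"] T_nonneg
    by force
  have "k \<le> nat \<lceil>E y / b\<rceil>" if "k \<in> ?S" for k
  proof -
    have "real k \<le> E y / b"
      using level_le[OF maximum] that b_pos by (simp add: field_simps)
    then show ?thesis
      using real_nat_ceiling_ge[of "E y / b"] by linarith
  qed
  then have "finite ?S"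
    by (intro finite_subset[of ?S "{..nat \<lceil>E y / b\<rceil>}"]) auto
  then have "?S = {1..card ?S}"
  proof (rule initial_segment_eq_Icc_card)
    show "j \<in> ?S" if "k \<in> ?S" "1 \<le> j" "j \<le> k" for j k
      using that tau_strict_mono[of j k] by (cases "j = k") auto
  qed simp
  then show ?thesis
    by (simp add: count_hits_def \<tau>_def)
qed

lemma count_hits_le:
  assumes "\<And>x. x \<in> {0..T} \<Longrightarrow> E x \<le> X"
  shows "real (count_hits E b T) * b \<le> X"
proof (cases "count_hits E b T = 0")
  case True
  then show ?thesis
    using assms[of 0] T_nonneg E_0 by simp
next
  case False
  then have "count_hits E b T \<in> {k. 1 \<le> k \<and> \<tau> k \<le> T}"
    unfolding hits_eq_Icc by simp
  then show ?thesis
    using level_le[OF assms] by simp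
qed

end

locale regular_energy_path = energy_path +
  assumes crossing: "1 \<le> k \<Longrightarrow> \<tau> k < x \<Longrightarrow> \<exists>u\<in>{\<tau> k<..<x}. real k * b < E u"
    and E_T: "1 \<le> k \<Longrightarrow> E T \<noteq> real k * b"
begin

lemma tau_neq_T: "1 \<le> k \<Longrightarrow> \<tau> k \<noteq> T"
  using E_tau E_T by metis

end

section \<open>Switching paths\<close>

definition pairing :: "(real \<Rightarrow> real) \<Rightarrow> (real \<Rightarrow> real) \<Rightarrow> real" where
  "pairing f g = (LBINT t:{0<..}. f t * g t)"

lemma LBINT_mean_value:
  fixes \<phi> :: "real \<Rightarrow> real"
  assumes \<phi>_continuous: "continuous_on {u..v} \<phi>" and "u \<le> v"
  obtains \<xi> where "\<xi> \<in> {u..v}" "(LBINT t:{u..<v}. \<phi> t) = (v - u) * \<phi> \<xi>"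
proof (cases "u = v")
  case True
  then show ?thesis
    using that[of u] by (simp add: set_lebesgue_integral_def)
next
  case False
  then have less: "u < v"
    using assms(2) by simp
  obtain G where antiderivative:
    "\<And>x. x \<in> {u..v} \<Longrightarrow> (G has_vector_derivative \<phi> x) (at x within {u..v})"
    using antiderivative_continuous[OF \<phi>_continuous] by blast
  have "(LBINT t:{u..<v}. \<phi> t) = (LBINT t:{u..v}. \<phi> t)"
  proof (rule set_integral_cong_set)
    have "set_borel_measurable lborel {u..v} \<phi>"
      using borel_measurable_continuous_on_indicator[OF _ \<phi>_continuous]
      by (simp add: set_borel_measurable_def)
    then show "set_borel_measurable lborel {u..v} \<phi>" "set_borel_measurable lborel {u..<v} \<phi>"
      by (auto intro: set_borel_measurable_subset)
    show "AE x in lborel. (x \<in> {u..v}) = (x \<in> {u..<v})"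
      using AE_lborel_singleton[of v] by eventually_elim auto
  qed
  also have "\<dots> = G v - G u"
    unfolding set_lebesgue_integral_def using antiderivative \<phi>_continuous assms(2)
    by (intro integral_FTC_atLeastAtMost) auto
  finally have "(LBINT t:{u..<v}. \<phi> t) = G v - G u" .
  moreover obtain \<xi> where "\<xi> \<in> {u<..<v}" "G v - G u = (v - u) * \<phi> \<xi>"
    using mvt_simple[OF less, of G "\<lambda>x h. h * \<phi> x"] antiderivative
    by (auto simp: has_vector_derivative_def)
  ultimately show ?thesis
    using that[of \<xi>] by simp
qed

text \<open>Counting from \<open>0\<close>, the \<open>k\<close>-th burst is \<open>[on_time k, off_time (k + 1))\<close>; it is empty once \<open>T\<close>
  is reached.\<close>

primrec off_time :: "(real \<Rightarrow> real) \<Rightarrow> real \<Rightarrow> real \<Rightarrow> nat \<Rightarrow> real" where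
  "off_time q b T 0 = 0"
| "off_time q b T (Suc k) = first_hit q T (first_hit q T (off_time q b T k) b) 0"

definition on_time :: "(real \<Rightarrow> real) \<Rightarrow> real \<Rightarrow> real \<Rightarrow> nat \<Rightarrow> real" where
  "on_time q b T k = first_hit q T (off_time q b T k) b"

lemma off_time_Suc: "off_time q b T (Suc k) = first_hit q T (on_time q b T k) 0"
  by (simp add: on_time_def)

declare off_time.simps(2) [simp del]

locale switching_path =
  fixes m r b D0 D1 T \<epsilon> :: real and w q \<sigma> :: "real \<Rightarrow> real"
  assumes r_pos: "0 < r" and b_pos: "0 < b" and D1_nonneg: "0 \<le> D1" and T_nonneg: "0 \<le> T"
    and \<epsilon>_pos: "0 < \<epsilon>"
    and solution: "switching_solution m r b D0 D1 T \<epsilon> w q \<sigma>"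
begin

abbreviation E :: "real \<Rightarrow> real" where
  "E \<equiv> energy m D0 w"

abbreviation on :: "nat \<Rightarrow> real" where
  "on \<equiv> on_time q b T"

abbreviation off :: "nat \<Rightarrow> real" where
  "off \<equiv> off_time q b T"

definition burst_mass :: "nat \<Rightarrow> real" where
  "burst_mass k = r / \<epsilon> * (off (Suc k) - on k)"

definition burst :: "(real \<Rightarrow> real) \<Rightarrow> nat \<Rightarrow> real" where
  "burst \<phi> k = r / \<epsilon> * (LBINT t:{on k..<off (Suc k)}. \<phi> t)"

lemma q_continuous: "continuous_on {0..T} q" and q_0: "q 0 = 0"
  using solution by (simp_all add: switching_solution_def)

lemma sigma_eq:
  "t \<in> {0..T} \<Longrightarrow>
    \<sigma> t = (if \<exists>s\<in>{0..t}. q s = b \<and> (\<forall>u\<in>{s..t}. q u \<noteq> 0) then r / \<epsilon> else 0)"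
  using solution by (simp add: switching_solution_def)

lemma sigma_after: "T < t \<Longrightarrow> \<sigma> t = 0"
  using solution by (simp add: switching_solution_def)

lemma q_continuous_from: "0 \<le> t \<Longrightarrow> continuous_on {t..T} q"
  by (rule continuous_on_subset[OF q_continuous]) auto

lemma off_bounds: "0 \<le> off k \<and> off k \<le> T"
proof (induction k)
  case (Suc k)
  then have on_bounds: "off k \<le> on k" "on k \<le> T"
    using first_hit_ge first_hit_le q_continuous_from by (auto simp: on_time_def)
  then show ?case
    using first_hit_ge[OF q_continuous_from on_bounds(2), of 0]
        first_hit_le[OF q_continuous_from on_bounds(2), of 0] Suc
    by (simp add: off_time_Suc)
qed (use T_nonneg in simp)

lemma off_nonneg: "0 \<le> off k" and off_le_T: "off k \<le> T"
  using off_bounds by simp_all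

lemmas first_hit_from_off = q_continuous_from[OF off_nonneg] off_le_T

lemma off_le_on: "off k \<le> on k" and on_le_T: "on k \<le> T"
  unfolding on_time_def
  by (rule first_hit_ge[OF first_hit_from_off] first_hit_le[OF first_hit_from_off])+

lemma on_nonneg: "0 \<le> on k"
  using off_nonneg[of k] off_le_on[of k] by simp

lemmas first_hit_from_on = q_continuous_from[OF on_nonneg] on_le_T

lemma on_le_off: "on k \<le> off (Suc k)"
  unfolding off_time_Suc by (rule first_hit_ge[OF first_hit_from_on])

lemma q_on: "on k < T \<Longrightarrow> q (on k) = b"
  unfolding on_time_def by (rule at_first_hit[OF first_hit_from_off])

lemma q_off: "off k < T \<Longrightarrow> q (off k) = 0"
  using at_first_hit[OF first_hit_from_on] q_0 by (cases k) (simp_all add: off_time_Suc)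

lemma q_before_on: "off k \<le> x \<Longrightarrow> x < on k \<Longrightarrow> q x \<noteq> b"
  unfolding on_time_def by (rule before_first_hit[OF first_hit_from_off])

lemma q_before_off: "on k \<le> x \<Longrightarrow> x < off (Suc k) \<Longrightarrow> q x \<noteq> 0"
  unfolding off_time_Suc by (rule before_first_hit[OF first_hit_from_on])

lemma sigma_eq_0:
  assumes t_bounds: "off k \<le> t" "t < on k"
  shows "\<sigma> t = 0"
proof -
  have "q (off k) = 0"
    using t_bounds on_le_T[of k] by (intro q_off) simp
  then have "\<not> (q s = b \<and> (\<forall>u\<in>{s..t}. q u \<noteq> 0))" if "s \<in> {0..t}" for s
    using that t_bounds q_before_on[of k s] by (cases "off k \<le> s") auto
  then have "\<not> (\<exists>s\<in>{0..t}. q s = b \<and> (\<forall>u\<in>{s..t}. q u \<noteq> 0))"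
    by blast
  then show ?thesis
    using sigma_eq[of t] t_bounds off_nonneg[of k] on_le_T[of k] by (simp only: if_False) simp
qed

lemma sigma_eq_rate:
  assumes t_bounds: "on k \<le> t" "t < off (Suc k)"
  shows "\<sigma> t = r / \<epsilon>"
proof -
  have "q (on k) = b"
    using t_bounds off_le_T[of "Suc k"] by (intro q_on) simp
  then have "\<exists>s\<in>{0..t}. q s = b \<and> (\<forall>u\<in>{s..t}. q u \<noteq> 0)"
    using t_bounds on_nonneg[of k] q_before_off[of k] by (intro bexI[of _ "on k"]) auto
  then show ?thesis
    using sigma_eq[of t] t_bounds on_nonneg[of k] off_le_T[of "Suc k"] by auto
qed

lemma q_diff_off:
  assumes "off k \<le> x" "x \<le> on k"
  shows "q x - q (off k) = E x - E (off k)"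
proof -
  have "\<forall>u\<in>{off k..<x}. \<sigma> u = 0"
    using assms sigma_eq_0[of k] by auto
  then have "q x - q (off k) = m * (x - off k) + D0 * (w x - w (off k))"
    using solution assms off_nonneg[of k] on_le_T[of k] by (auto simp: switching_solution_def)
  then show ?thesis
    by (simp add: energy_def algebra_simps)
qed

lemma q_diff_on: "q (off (Suc k)) - q (on k) = D1 * (w (off (Suc k)) - w (on k)) - burst_mass k"
proof -
  have "\<forall>u\<in>{on k..<off (Suc k)}. \<sigma> u = r / \<epsilon>"
    using sigma_eq_rate[of k] by auto
  then have "q (off (Suc k)) - q (on k)
      = - (r / \<epsilon>) * (off (Suc k) - on k) + D1 * (w (off (Suc k)) - w (on k))"
    using solution off_le_T[of "Suc k"] on_nonneg[of k] on_le_off[of k]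
    unfolding switching_solution_def by blast
  then show ?thesis
    by (simp add: burst_mass_def)
qed

lemma on_eq_first_hit_energy: "on k = first_hit E T (off k) (E (off k) + b)"
proof (rule first_hit_eqI[symmetric])
  show "E (on k) = E (off k) + b" if "on k < T"
    using q_diff_off[OF off_le_on order_refl, of k] q_on[OF that] q_off[of k] off_le_on[of k] that
    by simp
  show "E y \<noteq> E (off k) + b" if "off k \<le> y" "y < on k" for y
    using q_diff_off[of k y] q_before_on[of k y] q_off[of k] on_le_T[of k] that by auto
qed (rule off_le_on on_le_T)+

lemma burst_mass_nonneg: "0 \<le> burst_mass k"
  using r_pos \<epsilon>_pos on_le_off[of k] by (simp add: burst_mass_def)

lemma burst_mass_eq:
  assumes "off (Suc k) < T"
  shows "burst_mass k = b + D1 * (w (off (Suc k)) - w (on k))"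
  using q_diff_on[of k] q_off[OF assms] q_on[of k] on_le_off[of k] assms by simp

lemma q_off_nonneg:
  assumes "on k < T"
  shows "0 \<le> q (off (Suc k))"
proof (rule ccontr)
  assume negative: "\<not> 0 \<le> q (off (Suc k))"
  have "continuous_on {on k..off (Suc k)} q"
    using off_le_T[of "Suc k"] by (intro continuous_on_subset[OF first_hit_from_on(1)]) auto
  then obtain x where zero: "on k \<le> x" "x \<le> off (Suc k)" "q x = 0"
    using IVT2'[of q "off (Suc k)" 0 "on k"] negative q_on[OF assms] b_pos on_le_off[of k] by auto
  then have "x = off (Suc k)"
    using q_before_off[of k x] by force
  then show False
    using zero negative by simp
qed

lemma burst_mass_le:
  assumes w_bound: "\<And>x. x \<in> {0..T} \<Longrightarrow> \<bar>w x\<bar> \<le> X"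
  shows "burst_mass k \<le> b + 2 * D1 * X"
proof (cases "on k < T")
  case True
  have "w (off (Suc k)) - w (on k) \<le> 2 * X"
    using w_bound[of "off (Suc k)"] w_bound[of "on k"] off_nonneg off_le_T on_nonneg on_le_T
    by (auto simp: abs_le_iff)
  then have "D1 * (w (off (Suc k)) - w (on k)) \<le> D1 * (2 * X)"
    using D1_nonneg by (rule mult_left_mono)
  then show ?thesis
    using q_diff_on[of k] q_off_nonneg[OF True] q_on[OF True] by simp
next
  case False
  then have "burst_mass k = 0"
    using off_le_T[of "Suc k"] on_le_off[of k] by (simp add: burst_mass_def)
  moreover have "0 \<le> X"
    using w_bound[of 0] T_nonneg by force
  ultimately show ?thesis
    using b_pos D1_nonneg by simp
qed

lemma burst_eq_mass_mult:
  assumes "continuous_on UNIV \<phi>"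
  obtains \<xi> where "\<xi> \<in> {on k..off (Suc k)}" "burst \<phi> k = burst_mass k * \<phi> \<xi>"
proof -
  obtain \<xi> where "\<xi> \<in> {on k..off (Suc k)}"
    "(LBINT t:{on k..<off (Suc k)}. \<phi> t) = (off (Suc k) - on k) * \<phi> \<xi>"
    using LBINT_mean_value[OF continuous_on_subset[OF assms] on_le_off] by blast
  then show ?thesis
    by (intro that[of \<xi>]) (simp_all add: burst_def burst_mass_def)
qed

lemma off_eq_T:
  assumes gap: "\<And>x y. x \<in> {0..T} \<Longrightarrow> y \<in> {0..T} \<Longrightarrow> b \<le> \<bar>E x - E y\<bar> \<Longrightarrow> \<delta> \<le> \<bar>x - y\<bar>"
    and n_large: "T \<le> real n * \<delta>"
  shows "off n = T"
proof -
  have "off n < T \<Longrightarrow> real n * \<delta> \<le> off n" for n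
  proof (induction n)
    case (Suc n)
    then have before_end: "on n < T" "off n < T"
      using on_le_off[of n] off_le_on[of n] by simp_all
    have "E (on n) - E (off n) = b"
      using q_diff_off[OF off_le_on order_refl, of n] q_on[OF before_end(1)] q_off[OF before_end(2)]
      by simp
    then have "\<delta> \<le> \<bar>on n - off n\<bar>"
      using off_nonneg off_le_T on_nonneg on_le_T by (intro gap) auto
    then show ?case
      using Suc.IH[OF before_end(2)] off_le_on[of n] on_le_off[of n] by (simp add: distrib_right)
  qed simp
  from this[of n] n_large off_le_T[of n] show ?thesis
    by linarith
qed

lemma sum_bursts_eq_sigma:
  assumes "0 \<le> t"
  shows "(\<Sum>k<n. r / \<epsilon> * indicator {on k..<off (Suc k)} t) = (if t < off n then \<sigma> t else 0)"
proof (induction n)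
  case (Suc n)
  consider "t < off n" | "off n \<le> t" "t < on n" | "on n \<le> t" "t < off (Suc n)" | "off (Suc n) \<le> t"
    by linarith
  then show ?case
    using Suc sigma_eq_0[of n t] sigma_eq_rate[of n t] off_le_on[of n] on_le_off[of n]
    by cases auto
qed (use assms in simp)

lemma sigma_eq_sum_bursts:
  assumes "off n = T"
  shows "indicator {0<..} t * \<sigma> t
    = (\<Sum>k<n. r / \<epsilon> * indicator {on k..<off (Suc k)} t) + \<sigma> T * indicator {T} t"
proof (cases "0 \<le> t")
  case True
  have "\<sigma> 0 = 0"
    using sigma_eq[of 0] q_0 b_pos T_nonneg by simp
  then show ?thesis
    using sum_bursts_eq_sigma[OF True, of n] True sigma_after[of t] assms
    by (cases t T rule: linorder_cases) (auto simp: indicator_def)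
next
  case False
  then have "indicat_real {on k..<off (Suc k)} t = 0" for k
    using on_nonneg[of k] by simp
  then show ?thesis
    using False T_nonneg by simp
qed

lemma pairing_eq_sum_bursts:
  assumes \<phi>_continuous: "continuous_on UNIV \<phi>" and off_end: "off n = T"
  shows "pairing \<sigma> \<phi> = (\<Sum>k<n. burst \<phi> k)"
proof -
  have integrable: "integrable lborel (\<lambda>t. indicat_real {x..<y} t * \<phi> t)" for x y
  proof -
    have "set_integrable lborel {x..y} \<phi>"
      by (rule borel_integrable_atLeastAtMost')
          (rule continuous_on_subset[OF \<phi>_continuous subset_UNIV])
    then have "set_integrable lborel {x..<y} \<phi>"
      by (rule set_integrable_subset) auto
    then show ?thesis
      by (simp add: set_integrable_def)
  qed
  have "indicat_real {0<..} t * (\<sigma> t * \<phi> t)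
      = (\<Sum>k<n. r / \<epsilon> * (indicat_real {on k..<off (Suc k)} t * \<phi> t))
        + \<sigma> T * \<phi> T * indicat_real {T} t" for t
  proof -
    have "indicat_real {0<..} t * (\<sigma> t * \<phi> t) = (indicator {0<..} t * \<sigma> t) * \<phi> t"
      by simp
    also have "\<dots> = (\<Sum>k<n. r / \<epsilon> * (indicat_real {on k..<off (Suc k)} t * \<phi> t))
          + \<sigma> T * indicator {T} t * \<phi> t"
      by (simp only: sigma_eq_sum_bursts[OF off_end] distrib_right sum_distrib_right mult.assoc)
    finally show ?thesis
      by (simp add: indicator_def)
  qed
  then have "pairing \<sigma> \<phi> = (\<integral>t. (\<Sum>k<n. r / \<epsilon> * (indicat_real {on k..<off (Suc k)} t * \<phi> t))
      + \<sigma> T * \<phi> T * indicat_real {T} t \<partial>lborel)"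
    by (simp add: pairing_def set_lebesgue_integral_def)
  also have "\<dots> = (\<Sum>k<n. r / \<epsilon> * (\<integral>t. indicat_real {on k..<off (Suc k)} t * \<phi> t \<partial>lborel))"
    using integrable by (subst Bochner_Integration.integral_add) auto
  finally show ?thesis
    by (simp add: burst_def set_lebesgue_integral_def)
qed

lemma abs_pairing_le:
  assumes gap: "\<And>x y. x \<in> {0..T} \<Longrightarrow> y \<in> {0..T} \<Longrightarrow> b \<le> \<bar>E x - E y\<bar> \<Longrightarrow> \<delta> \<le> \<bar>x - y\<bar>" "0 < \<delta>"
    and w_bound: "\<And>x. x \<in> {0..T} \<Longrightarrow> \<bar>w x\<bar> \<le> X"
    and test_function: "continuous_on UNIV \<phi>" "\<And>t. \<bar>\<phi> t\<bar> \<le> \<Phi>"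
  shows "\<bar>pairing \<sigma> \<phi>\<bar> \<le> (T / \<delta> + 1) * ((b + 2 * D1 * X) * \<Phi>)"
proof -
  have nonneg: "0 \<le> (b + 2 * D1 * X) * \<Phi>"
    using w_bound[of 0] test_function(2)[of 0] b_pos D1_nonneg T_nonneg by force
  have burst_le: "\<bar>burst \<phi> k\<bar> \<le> (b + 2 * D1 * X) * \<Phi>" for k
  proof -
    obtain \<xi> where "burst \<phi> k = burst_mass k * \<phi> \<xi>"
      using burst_eq_mass_mult[OF test_function(1)] .
    moreover have "burst_mass k * \<bar>\<phi> \<xi>\<bar> \<le> (b + 2 * D1 * X) * \<Phi>"
      using burst_mass_le[OF w_bound] burst_mass_nonneg test_function(2) by (intro mult_mono') auto
    ultimately show ?thesis
      by (simp add: abs_mult burst_mass_nonneg)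
  qed
  define n where "n = nat \<lceil>T / \<delta>\<rceil>"
  have n_bounds: "T / \<delta> \<le> real n" "real n \<le> T / \<delta> + 1"
    using T_nonneg gap(2)
    by (auto simp: n_def intro: order_trans[OF real_nat_ceiling_ge] less_imp_le)
  then have "off n = T"
    using gap(2) by (intro off_eq_T[OF gap(1)]) (simp_all add: pos_divide_le_eq)
  then have "\<bar>pairing \<sigma> \<phi>\<bar> \<le> (\<Sum>k<n. (b + 2 * D1 * X) * \<Phi>)"
    unfolding pairing_eq_sum_bursts[OF test_function(1) \<open>off n = T\<close>]
    by (intro order_trans[OF sum_abs] sum_mono burst_le)
  also have "\<dots> = real n * ((b + 2 * D1 * X) * \<Phi>)"
    by simp
  also have "\<dots> \<le> (T / \<delta> + 1) * ((b + 2 * D1 * X) * \<Phi>)"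
    using n_bounds(2) nonneg by (rule mult_right_mono)
  finally show ?thesis .
qed

end

section \<open>The pairing error along a path\<close>

definition impulse_pairing :: "real \<Rightarrow> real \<Rightarrow> (real \<Rightarrow> real) \<Rightarrow> (real \<Rightarrow> real) \<Rightarrow> real" where
  "impulse_pairing b T e \<phi> = b * (\<Sum>i\<in>{1..count_hits e b T}. \<phi> (hit_time e (real i * b)))"

lemma (in energy_path) abs_impulse_pairing_le:
  assumes E_le: "\<And>x. x \<in> {0..T} \<Longrightarrow> E x \<le> Y" and \<phi>_bound: "\<And>t. \<bar>\<phi> t\<bar> \<le> \<Phi>"
  shows "\<bar>impulse_pairing b T E \<phi>\<bar> \<le> Y * \<Phi>"
proof -
  have "\<bar>\<Sum>i\<in>{1..count_hits E b T}. \<phi> (\<tau> i)\<bar> \<le> (\<Sum>i\<in>{1..count_hits E b T}. \<Phi>)"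
    by (intro order_trans[OF sum_abs] sum_mono \<phi>_bound)
  then have "\<bar>impulse_pairing b T E \<phi>\<bar> \<le> b * (real (count_hits E b T) * \<Phi>)"
    using b_pos by (simp add: impulse_pairing_def \<tau>_def abs_mult)
  also have "\<dots> = real (count_hits E b T) * b * \<Phi>"
    by simp
  also have "\<dots> \<le> Y * \<Phi>"
    using count_hits_le[OF E_le] \<phi>_bound[of 0] by (intro mult_right_mono) auto
  finally show ?thesis .
qed

lemma hoelder_on_energy:
  assumes w_hoelder: "hoelder_on \<gamma> C {0..T} w" and \<gamma>_le_1: "\<gamma> \<le> 1"
  shows "hoelder_on \<gamma> (\<bar>m\<bar> * T powr (1 - \<gamma>) + \<bar>D\<bar> * C) {0..T} (energy m D w)"
  unfolding hoelder_on_def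
proof (intro ballI)
  fix x y assume xy_in: "x \<in> {0..T}" "y \<in> {0..T}"
  have "\<bar>x - y\<bar> = \<bar>x - y\<bar> powr (1 - \<gamma>) * \<bar>x - y\<bar> powr \<gamma>"
    by (simp flip: powr_add)
  also have "\<dots> \<le> T powr (1 - \<gamma>) * \<bar>x - y\<bar> powr \<gamma>"
    using xy_in \<gamma>_le_1 by (intro mult_right_mono powr_mono2) auto
  finally have "\<bar>m\<bar> * \<bar>x - y\<bar> \<le> \<bar>m\<bar> * (T powr (1 - \<gamma>) * \<bar>x - y\<bar> powr \<gamma>)"
    by (rule mult_left_mono) simp
  moreover have "\<bar>D\<bar> * \<bar>w x - w y\<bar> \<le> \<bar>D\<bar> * (C * \<bar>x - y\<bar> powr \<gamma>)"
    using hoelder_onD[OF w_hoelder xy_in] by (intro mult_left_mono) (simp_all add: dist_real_def)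
  moreover have "dist (energy m D w x) (energy m D w y) = \<bar>m * (x - y) + D * (w x - w y)\<bar>"
    by (simp add: energy_def dist_real_def algebra_simps)
  then have "dist (energy m D w x) (energy m D w y) \<le> \<bar>m\<bar> * \<bar>x - y\<bar> + \<bar>D\<bar> * \<bar>w x - w y\<bar>"
    using abs_triangle_ineq[of "m * (x - y)" "D * (w x - w y)"] by (simp only: abs_mult)
  ultimately show "dist (energy m D w x) (energy m D w y)
      \<le> (\<bar>m\<bar> * T powr (1 - \<gamma>) + \<bar>D\<bar> * C) * dist x y powr \<gamma>"
    by (simp add: dist_real_def distrib_right mult.assoc)
qed

lemma hoelder_on_energy_mult:
  assumes "hoelder_on \<gamma> K {0..T} w" "\<gamma> \<le> 1" "1 \<le> K"
  shows "hoelder_on \<gamma> ((\<bar>m\<bar> * T powr (1 - \<gamma>) + \<bar>D\<bar>) * K) {0..T} (energy m D w)"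
proof (rule hoelder_on_mono[OF hoelder_on_energy[OF assms(1,2)]])
  have "\<bar>m\<bar> * T powr (1 - \<gamma>) * 1 \<le> \<bar>m\<bar> * T powr (1 - \<gamma>) * K"
    using assms(3) by (intro mult_left_mono) auto
  then show "\<bar>m\<bar> * T powr (1 - \<gamma>) + \<bar>D\<bar> * K \<le> (\<bar>m\<bar> * T powr (1 - \<gamma>) + \<bar>D\<bar>) * K"
    by (simp add: distrib_right)
qed

lemma hoelder_on_imp_abs_le:
  fixes f :: "real \<Rightarrow> real"
  assumes "hoelder_on \<gamma> C {0..T} f" "f 0 = 0" "0 \<le> C" "0 \<le> \<gamma>" "x \<in> {0..T}"
  shows "\<bar>f x\<bar> \<le> C * T powr \<gamma>"
proof -
  have "\<bar>f x\<bar> \<le> C * x powr \<gamma>"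
    using hoelder_onD[OF assms(1,5), of 0] assms(2,5) by (simp add: dist_real_def)
  also have "\<dots> \<le> C * T powr \<gamma>"
    using assms by (intro mult_left_mono powr_mono2) auto
  finally show ?thesis .
qed

lemma hoelder_on_separation:
  assumes f_hoelder: "hoelder_on \<gamma> C S f" and separated: "x \<in> S" "y \<in> S" "d \<le> dist (f x) (f y)"
    and "0 < \<gamma>" "0 < C" "0 \<le> d"
  shows "(d / C) powr (1 / \<gamma>) \<le> dist x y"
proof -
  have "d / C \<le> dist x y powr \<gamma>"
    using hoelder_onD[OF f_hoelder separated(1,2)] separated(3) \<open>0 < C\<close>
    by (simp add: divide_le_eq mult.commute)
  then have "(d / C) powr (1 / \<gamma>) \<le> (dist x y powr \<gamma>) powr (1 / \<gamma>)"
    using assms(5-7) by (intro powr_mono2) auto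
  then show ?thesis
    using \<open>0 < \<gamma>\<close> by (simp add: powr_powr)
qed

locale switching_family = energy_path "energy m D0 w" b T
  for m D0 b T :: real and w :: "real \<Rightarrow> real" +
  fixes r D1 :: real and q \<sigma> :: "real \<Rightarrow> real \<Rightarrow> real"
  assumes r_pos: "0 < r" and D1_nonneg: "0 \<le> D1"
    and w_continuous: "continuous_on {0..} w" and w_0: "w 0 = 0"
    and solution: "0 < \<epsilon> \<Longrightarrow> switching_solution m r b D0 D1 T \<epsilon> w (q \<epsilon>) (\<sigma> \<epsilon>)"
begin

abbreviation E :: "real \<Rightarrow> real" where
  "E \<equiv> energy m D0 w"

abbreviation on :: "real \<Rightarrow> nat \<Rightarrow> real" where
  "on \<epsilon> \<equiv> on_time (q \<epsilon>) b T"

abbreviation off :: "real \<Rightarrow> nat \<Rightarrow> real" where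
  "off \<epsilon> \<equiv> off_time (q \<epsilon>) b T"

abbreviation burst_mass :: "real \<Rightarrow> nat \<Rightarrow> real" where
  "burst_mass \<epsilon> \<equiv> switching_path.burst_mass r b T \<epsilon> (q \<epsilon>)"

abbreviation burst :: "real \<Rightarrow> (real \<Rightarrow> real) \<Rightarrow> nat \<Rightarrow> real" where
  "burst \<epsilon> \<equiv> switching_path.burst r b T \<epsilon> (q \<epsilon>)"

lemma switching_path_at: "0 < \<epsilon> \<Longrightarrow> switching_path m r b D0 D1 T \<epsilon> w (q \<epsilon>) (\<sigma> \<epsilon>)"
  using r_pos b_pos D1_nonneg T_nonneg solution by unfold_locales auto

lemma pairing_error_le:
  assumes \<epsilon>_pos: "0 < \<epsilon>" and \<gamma>_pos: "0 < \<gamma>"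
    and w_hoelder: "hoelder_on \<gamma> K {0..T} w" and K_nonneg: "0 \<le> K"
    and E_hoelder: "hoelder_on \<gamma> H {0..T} E" and H_pos: "0 < H"
    and test_function: "continuous_on UNIV \<phi>" "\<And>t. \<bar>\<phi> t\<bar> \<le> \<Phi>"
  shows "\<bar>pairing (\<sigma> \<epsilon>) \<phi> - impulse_pairing b T E \<phi>\<bar>
    \<le> (T / (b / H) powr (1 / \<gamma>) + 1) * ((b + 2 * D1 * (K * T powr \<gamma>)) * \<Phi>) + H * T powr \<gamma> * \<Phi>"
proof -
  interpret path: switching_path m r b D0 D1 T \<epsilon> w "q \<epsilon>" "\<sigma> \<epsilon>"
    using \<epsilon>_pos by (rule switching_path_at)
  have "\<bar>pairing (\<sigma> \<epsilon>) \<phi>\<bar> \<le> (T / (b / H) powr (1 / \<gamma>) + 1) * ((b + 2 * D1 * (K * T powr \<gamma>)) * \<Phi>)"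
  proof (rule path.abs_pairing_le[OF _ _ _ test_function])
    show "(b / H) powr (1 / \<gamma>) \<le> \<bar>x - y\<bar>" if "x \<in> {0..T}" "y \<in> {0..T}" "b \<le> \<bar>E x - E y\<bar>" for x y
      using hoelder_on_separation[OF E_hoelder that(1,2), of b] that(3) \<gamma>_pos H_pos b_pos
      by (simp add: dist_real_def)
    show "0 < (b / H) powr (1 / \<gamma>)"
      using b_pos H_pos by simp
    show "\<bar>w x\<bar> \<le> K * T powr \<gamma>" if "x \<in> {0..T}" for x
      using hoelder_on_imp_abs_le[OF w_hoelder w_0 K_nonneg _ that] \<gamma>_pos by simp
  qed
  moreover have "\<bar>impulse_pairing b T E \<phi>\<bar> \<le> H * T powr \<gamma> * \<Phi>"
    using hoelder_on_imp_abs_le[OF E_hoelder E_0] H_pos \<gamma>_pos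
    by (intro abs_impulse_pairing_le test_function) (simp add: abs_le_iff)
  ultimately show ?thesis
    by linarith
qed

definition error_constant :: "real \<Rightarrow> real" where
  "error_constant \<Phi> = (let c = \<bar>m\<bar> * T powr (2 / 3) + \<bar>D0\<bar> in
     ((T * (c / b) ^ 3 + 1) * (b + 2 * D1 * T powr (1 / 3)) + c * T powr (1 / 3)) * \<Phi>)"

lemma pairing_error_le_power4:
  assumes "0 < \<epsilon>" "D0 \<noteq> 0" and K_ge_1: "1 \<le> K" and w_hoelder: "hoelder_on (1 / 3) K {0..T} w"
    and test_function: "continuous_on UNIV \<phi>" "\<And>t. \<bar>\<phi> t\<bar> \<le> \<Phi>"
  shows "\<bar>pairing (\<sigma> \<epsilon>) \<phi> - impulse_pairing b T E \<phi>\<bar> \<le> error_constant \<Phi> * K ^ 4"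
proof -
  define c where "c = \<bar>m\<bar> * T powr (2 / 3) + \<bar>D0\<bar>"
  have c_pos: "0 < c"
    using assms(2) by (simp add: c_def add_nonneg_pos)
  have \<Phi>_nonneg: "0 \<le> \<Phi>"
    using test_function(2)[of 0] by simp
  have E_hoelder: "hoelder_on (1 / 3) (c * K) {0..T} E"
    using hoelder_on_energy_mult[OF w_hoelder _ K_ge_1, of m D0] by (simp add: c_def)
  define A where "A = T * (c / b) ^ 3 + 1"
  define B where "B = b + 2 * D1 * T powr (1 / 3)"
  have A_bounds: "T / (b / (c * K)) powr (1 / (1 / 3)) + 1 \<le> A * K ^ 3" "0 \<le> A"
  proof -
    have "T / (b / (c * K)) powr (1 / (1 / 3)) = T * (c / b) ^ 3 * K ^ 3"
      using b_pos c_pos K_ge_1 by (simp add: powr_numeral power_divide power_mult_distrib)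
    then show "T / (b / (c * K)) powr (1 / (1 / 3)) + 1 \<le> A * K ^ 3" "0 \<le> A"
      using K_ge_1 T_nonneg b_pos c_pos by (simp_all add: A_def distrib_right)
  qed
  have B_bounds: "b + 2 * D1 * (K * T powr (1 / 3)) \<le> B * K" "0 \<le> b + 2 * D1 * (K * T powr (1 / 3))"
    using b_pos D1_nonneg K_ge_1 by (simp_all add: B_def distrib_right)
  have "\<bar>pairing (\<sigma> \<epsilon>) \<phi> - impulse_pairing b T E \<phi>\<bar>
      \<le> (T / (b / (c * K)) powr (1 / (1 / 3)) + 1) * ((b + 2 * D1 * (K * T powr (1 / 3))) * \<Phi>)
        + c * K * T powr (1 / 3) * \<Phi>"
    using c_pos K_ge_1 by (intro pairing_error_le assms(1) w_hoelder E_hoelder test_function) auto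
  also have "\<dots> \<le> (A * K ^ 3) * ((B * K) * \<Phi>) + c * K ^ 4 * T powr (1 / 3) * \<Phi>"
    using A_bounds B_bounds power_increasing[of 1 4 K] c_pos K_ge_1 \<Phi>_nonneg
    by (intro add_mono mult_mono mult_right_mono mult_left_mono) auto
  also have "\<dots> = (A * B + c * T powr (1 / 3)) * \<Phi> * K ^ 4"
    by (simp add: algebra_simps power4_eq_xxxx power3_eq_cube)
  also have "(A * B + c * T powr (1 / 3)) * \<Phi> = error_constant \<Phi>"
    by (simp add: error_constant_def A_def B_def c_def Let_def)
  finally show ?thesis .
qed

end

section \<open>Convergence along a path\<close>

locale regular_switching_family = switching_family + regular_energy_path "energy m D0 w" b T
begin

definition \<theta> :: "nat \<Rightarrow> real" where
  "\<theta> k = first_hit E T 0 (real k * b)"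

lemma theta_0: "\<theta> 0 = 0"
  unfolding \<theta>_def using T_nonneg E_0 by (intro first_hit_eqI) auto

lemma theta_eq_min_tau: "1 \<le> k \<Longrightarrow> \<theta> k = min T (\<tau> k)"
  by (simp add: \<theta>_def first_hit_eq_min_tau)

lemma E_continuous_upto: "continuous_on {0..T} E"
  by (rule continuous_on_subset[OF E_continuous]) auto

lemma theta_bounds: "0 \<le> \<theta> k" "\<theta> k \<le> T"
  unfolding \<theta>_def by (rule first_hit_ge[OF E_continuous_upto T_nonneg]
      first_hit_le[OF E_continuous_upto T_nonneg])+

lemma E_theta: "\<theta> k < T \<Longrightarrow> E (\<theta> k) = real k * b"
  unfolding \<theta>_def by (rule at_first_hit[OF E_continuous_upto T_nonneg])

lemma theta_less_Suc:
  assumes "\<theta> k < T"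
  shows "\<theta> k < \<theta> (Suc k)"
proof (cases k)
  case 0
  then show ?thesis
    using assms tau_pos[of "Suc 0"] by (simp add: theta_0 theta_eq_min_tau)
next
  case (Suc j)
  then have "\<tau> k < \<tau> (Suc k)"
    by (intro tau_strict_mono) auto
  then show ?thesis
    using assms Suc by (simp add: theta_eq_min_tau min_def split: if_splits)
qed

lemma eventually_switching_path: "eventually (\<lambda>\<epsilon>. switching_path m r b D0 D1 T \<epsilon> w (q \<epsilon>) (\<sigma> \<epsilon>)) (at_right 0)"
  using eventually_at_right_less[of 0] by eventually_elim (rule switching_path_at)

lemma eventually_off_in: "eventually (\<lambda>\<epsilon>. off \<epsilon> k \<in> {0..T}) (at_right 0)"
  using eventually_switching_path by eventually_elim (simp add: switching_path.off_bounds)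

lemma burst_length_tendsto: "((\<lambda>\<epsilon>. off \<epsilon> (Suc k) - on \<epsilon> k) \<longlongrightarrow> 0) (at_right 0)"
proof -
  have "continuous_on {0..T} (\<lambda>x. \<bar>w x\<bar>)"
    by (intro continuous_intros continuous_on_subset[OF w_continuous]) auto
  then obtain y where maximum: "\<And>x. x \<in> {0..T} \<Longrightarrow> \<bar>w x\<bar> \<le> \<bar>w y\<bar>"
    using continuous_attains_sup[of "{0..T}" "\<lambda>x. \<bar>w x\<bar>"] T_nonneg by force
  let ?B = "b + 2 * D1 * \<bar>w y\<bar>"
  show ?thesis
  proof (rule tendsto_sandwich)
    show "eventually (\<lambda>\<epsilon>. 0 \<le> off \<epsilon> (Suc k) - on \<epsilon> k) (at_right 0)"
      using eventually_switching_path by eventually_elim (simp add: switching_path.on_le_off)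
    show "eventually (\<lambda>\<epsilon>. off \<epsilon> (Suc k) - on \<epsilon> k \<le> \<epsilon> * (?B / r)) (at_right 0)"
      using eventually_switching_path eventually_at_right_less[of 0]
    proof eventually_elim
      case (elim \<epsilon>)
      have "r / \<epsilon> * (off \<epsilon> (Suc k) - on \<epsilon> k) \<le> ?B"
        using switching_path.burst_mass_le[OF elim(1) maximum]
        by (simp add: switching_path.burst_mass_def[OF elim(1)])
      then show ?case
        using elim(2) r_pos by (simp add: field_simps)
    qed
    have "((\<lambda>\<epsilon>. \<epsilon> * (?B / r)) \<longlongrightarrow> 0 * (?B / r)) (at_right 0)"
      by (intro tendsto_intros)
    then show "((\<lambda>\<epsilon>. \<epsilon> * (?B / r)) \<longlongrightarrow> 0) (at_right 0)"
      by simp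
  qed simp
qed

lemma off_Suc_tendsto:
  assumes "((\<lambda>\<epsilon>. on \<epsilon> k) \<longlongrightarrow> t) (at_right 0)"
  shows "((\<lambda>\<epsilon>. off \<epsilon> (Suc k)) \<longlongrightarrow> t) (at_right 0)"
  using tendsto_add[OF burst_length_tendsto[of k] assms] by simp

lemma eventually_on_eq_first_hit:
  "eventually (\<lambda>\<epsilon>. first_hit E T (off \<epsilon> k) (E (off \<epsilon> k) + b) = on \<epsilon> k) (at_right 0)"
  using eventually_switching_path by eventually_elim (rule switching_path.on_eq_first_hit_energy[symmetric])

lemma next_level_tendsto:
  assumes "((\<lambda>\<epsilon>. off \<epsilon> k) \<longlongrightarrow> \<theta> k) (at_right 0)" "\<theta> k < T"
  shows "((\<lambda>\<epsilon>. E (off \<epsilon> k) + b) \<longlongrightarrow> real (Suc k) * b) (at_right 0)"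
proof -
  have "((\<lambda>\<epsilon>. E (off \<epsilon> k)) \<longlongrightarrow> E (\<theta> k)) (at_right 0)"
    using theta_bounds[of k] assms(1) eventually_off_in
    by (intro continuous_on_tendsto_compose[OF E_continuous_upto]) auto
  from tendsto_add[OF this tendsto_const[of b]] show ?thesis
    using E_theta[OF assms(2)] by (simp add: algebra_simps)
qed

lemma on_tendsto_if_off_tendsto:
  assumes off_limit: "((\<lambda>\<epsilon>. off \<epsilon> k) \<longlongrightarrow> \<theta> k) (at_right 0)"
  shows "((\<lambda>\<epsilon>. on \<epsilon> k) \<longlongrightarrow> \<theta> (Suc k)) (at_right 0)"
proof (cases "\<theta> k < T")
  case True
  have first_hit_eq: "first_hit E T 0 (real (Suc k) * b) = min T (\<tau> (Suc k))"
    by (rule first_hit_eq_min_tau) simp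
  have "((\<lambda>\<epsilon>. first_hit E T (off \<epsilon> k) (E (off \<epsilon> k) + b)) \<longlongrightarrow> \<theta> (Suc k)) (at_right 0)"
    unfolding \<theta>_def
  proof (rule first_hit_tendsto[OF E_continuous_upto _ T_nonneg off_limit eventually_off_in
      next_level_tendsto[OF off_limit True]])
    show "E 0 < real (Suc k) * b"
      using b_pos E_0 by simp
    show "0 \<le> \<theta> k" "\<theta> k < first_hit E T 0 (real (Suc k) * b)"
      using theta_bounds(1) theta_less_Suc[OF True] by (simp_all only: \<theta>_def)
    show "\<exists>y\<in>{first_hit E T 0 (real (Suc k) * b)<..<x}. real (Suc k) * b < E y"
      if "first_hit E T 0 (real (Suc k) * b) < x" "x \<le> T" for x
      using that crossing[of "Suc k" x] unfolding first_hit_eq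
      by (simp add: min_def split: if_splits)
  qed
  then show ?thesis
    using eventually_on_eq_first_hit by (rule Lim_transform_eventually)
next
  case False
  then have theta_end: "\<theta> k = T" "\<theta> (Suc k) = T"
    using theta_bounds[of k] theta_bounds[of "Suc k"] tau_strict_mono[of k "Suc k"] T_nonneg
    by (cases k; simp add: theta_0 theta_eq_min_tau)+
  show ?thesis
    unfolding theta_end(2)
  proof (rule tendsto_sandwich[OF _ _ off_limit[unfolded theta_end(1)] tendsto_const])
    show "eventually (\<lambda>\<epsilon>. off \<epsilon> k \<le> on \<epsilon> k) (at_right 0)" "eventually (\<lambda>\<epsilon>. on \<epsilon> k \<le> T) (at_right 0)"
      using eventually_switching_path
      by (eventually_elim, simp add: switching_path.off_le_on switching_path.on_le_T)+
  qed
qed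

lemma off_tendsto: "((\<lambda>\<epsilon>. off \<epsilon> k) \<longlongrightarrow> \<theta> k) (at_right 0)"
proof (induction k)
  case 0
  then show ?case
    by (simp add: theta_0)
next
  case (Suc k)
  then show ?case
    by (intro off_Suc_tendsto on_tendsto_if_off_tendsto)
qed

lemmas on_tendsto = on_tendsto_if_off_tendsto[OF off_tendsto]

lemma eventually_on_eq_T_if_off:
  assumes not_reached: "T < \<tau> (Suc k)"
    and off_end: "\<theta> k = T \<Longrightarrow> eventually (\<lambda>\<epsilon>. off \<epsilon> k = T) (at_right 0)"
  shows "eventually (\<lambda>\<epsilon>. on \<epsilon> k = T) (at_right 0)"
proof (cases "\<theta> k < T")
  case True
  have "eventually (\<lambda>\<epsilon>. first_hit E T (off \<epsilon> k) (E (off \<epsilon> k) + b) = T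
      \<or> T < first_hit E T (off \<epsilon> k) (E (off \<epsilon> k) + b)) (at_right 0)"
    using T_nonneg E_before_tau[of "Suc k"] not_reached
    by (intro eventually_less_first_hit[OF E_continuous_upto _ _ _ eventually_off_in
        next_level_tendsto[OF off_tendsto True]]) auto
  with eventually_on_eq_first_hit[of k] eventually_switching_path show ?thesis
  proof eventually_elim
    case (elim \<epsilon>)
    then show ?case
      using switching_path.on_le_T[OF elim(2), of k] by simp
  qed
next
  case False
  then have "eventually (\<lambda>\<epsilon>. off \<epsilon> k = T) (at_right 0)"
    using off_end theta_bounds[of k] by simp
  with eventually_switching_path show ?thesis
  proof eventually_elim
    case (elim \<epsilon>)
    then show ?case
      using switching_path.off_le_on[OF elim(1), of k] switching_path.on_le_T[OF elim(1), of k]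
      by simp
  qed
qed

lemma eventually_on_eq_T:
  assumes "T < \<tau> (Suc k)"
  shows "eventually (\<lambda>\<epsilon>. on \<epsilon> k = T) (at_right 0)"
  using assms
proof (induction k)
  case 0
  then show ?case
    by (intro eventually_on_eq_T_if_off) (auto simp: theta_0)
next
  case (Suc k)
  show ?case
  proof (rule eventually_on_eq_T_if_off[OF Suc.prems])
    assume "\<theta> (Suc k) = T"
    then have "T < \<tau> (Suc k)"
      using tau_neq_T[of "Suc k"] by (simp add: theta_eq_min_tau min_def split: if_splits)
    from Suc.IH[OF this] eventually_switching_path show "eventually (\<lambda>\<epsilon>. off \<epsilon> (Suc k) = T) (at_right 0)"
    proof eventually_elim
      case (elim \<epsilon>)
      then show ?case
        using switching_path.on_le_off[OF elim(2), of k]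
          switching_path.off_le_T[OF elim(2), of "Suc k"] by simp
    qed
  qed
qed

lemma burst_mass_tendsto:
  assumes "\<tau> (Suc k) < T"
  shows "((\<lambda>\<epsilon>. burst_mass \<epsilon> k) \<longlongrightarrow> b) (at_right 0)"
proof -
  have on_limit: "((\<lambda>\<epsilon>. on \<epsilon> k) \<longlongrightarrow> \<tau> (Suc k)) (at_right 0)"
    using on_tendsto[of k] assms by (simp add: theta_eq_min_tau)
  note off_limit = off_Suc_tendsto[OF on_limit]
  have w_limit: "((\<lambda>\<epsilon>. w (s \<epsilon>)) \<longlongrightarrow> w (\<tau> (Suc k))) (at_right 0)"
    if "(s \<longlongrightarrow> \<tau> (Suc k)) (at_right 0)" for s
  proof (rule continuous_on_tendsto_compose[OF w_continuous that])
    show "eventually (\<lambda>\<epsilon>. s \<epsilon> \<in> {0..}) (at_right 0)"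
      using order_tendstoD(1)[OF that tau_pos] by (simp add: eventually_mono)
  qed (use tau_pos[of "Suc k"] in simp)
  have "((\<lambda>\<epsilon>. b + D1 * (w (off \<epsilon> (Suc k)) - w (on \<epsilon> k)))
      \<longlongrightarrow> b + D1 * (w (\<tau> (Suc k)) - w (\<tau> (Suc k)))) (at_right 0)"
    by (intro tendsto_intros w_limit on_limit off_limit)
  moreover have "eventually (\<lambda>\<epsilon>. b + D1 * (w (off \<epsilon> (Suc k)) - w (on \<epsilon> k)) = burst_mass \<epsilon> k)
      (at_right 0)"
    using order_tendstoD(2)[OF off_limit assms] eventually_switching_path
    by eventually_elim (rule switching_path.burst_mass_eq[symmetric])
  ultimately show ?thesis
    by (simp add: tendsto_cong)
qed

lemma burst_tendsto:
  assumes \<phi>_continuous: "continuous_on UNIV \<phi>" and reached: "\<tau> (Suc k) < T"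
  shows "((\<lambda>\<epsilon>. burst \<epsilon> \<phi> k) \<longlongrightarrow> b * \<phi> (\<tau> (Suc k))) (at_right 0)"
proof -
  have "\<forall>\<epsilon>\<in>{0<..}. \<exists>\<xi>. \<xi> \<in> {on \<epsilon> k..off \<epsilon> (Suc k)} \<and> burst \<epsilon> \<phi> k = burst_mass \<epsilon> k * \<phi> \<xi>"
    using switching_path.burst_eq_mass_mult[OF switching_path_at \<phi>_continuous] by (metis greaterThan_iff)
  from bchoice[OF this] obtain \<xi> where
    mean_value: "\<And>\<epsilon>. 0 < \<epsilon> \<Longrightarrow> \<xi> \<epsilon> \<in> {on \<epsilon> k..off \<epsilon> (Suc k)} \<and> burst \<epsilon> \<phi> k = burst_mass \<epsilon> k * \<phi> (\<xi> \<epsilon>)"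
    by auto
  have on_limit: "((\<lambda>\<epsilon>. on \<epsilon> k) \<longlongrightarrow> \<tau> (Suc k)) (at_right 0)"
    using on_tendsto[of k] reached by (simp add: theta_eq_min_tau)
  have "eventually (\<lambda>\<epsilon>. on \<epsilon> k \<le> \<xi> \<epsilon>) (at_right 0)"
    "eventually (\<lambda>\<epsilon>. \<xi> \<epsilon> \<le> off \<epsilon> (Suc k)) (at_right 0)"
    using mean_value by (auto intro: eventually_mono[OF eventually_at_right_less])
  from tendsto_sandwich[OF this on_limit off_Suc_tendsto[OF on_limit]]
  have "((\<lambda>\<epsilon>. burst_mass \<epsilon> k * \<phi> (\<xi> \<epsilon>)) \<longlongrightarrow> b * \<phi> (\<tau> (Suc k))) (at_right 0)"
    by (intro tendsto_mult burst_mass_tendsto[OF reached]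
        continuous_on_tendsto_compose[OF \<phi>_continuous]) auto
  then show ?thesis
  proof (rule Lim_transform_eventually)
    show "eventually (\<lambda>\<epsilon>. burst_mass \<epsilon> k * \<phi> (\<xi> \<epsilon>) = burst \<epsilon> \<phi> k) (at_right 0)"
      using eventually_at_right_less[of 0] by eventually_elim (simp add: mean_value)
  qed
qed

lemma burst_tendsto_0:
  assumes "T < \<tau> (Suc k)"
  shows "((\<lambda>\<epsilon>. burst \<epsilon> \<phi> k) \<longlongrightarrow> 0) (at_right 0)"
proof (rule tendsto_eventually)
  show "eventually (\<lambda>\<epsilon>. burst \<epsilon> \<phi> k = 0) (at_right 0)"
    using eventually_on_eq_T[OF assms] eventually_switching_path
  proof eventually_elim
    case (elim \<epsilon>)
    then show ?case
      using switching_path.off_le_T[OF elim(2), of "Suc k"]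
      by (simp add: switching_path.burst_def set_lebesgue_integral_def)
  qed
qed

lemma eventually_pairing_eq_sum_bursts:
  assumes \<phi>_continuous: "continuous_on UNIV \<phi>"
  obtains n where "count_hits E b T \<le> n"
    "eventually (\<lambda>\<epsilon>. pairing (\<sigma> \<epsilon>) \<phi> = (\<Sum>k<n. burst \<epsilon> \<phi> k)) (at_right 0)"
proof -
  have "uniformly_continuous_on {0..T} E"
    using E_continuous_upto by (intro compact_uniformly_continuous) auto
  then obtain \<delta> where modulus: "0 < \<delta>"
    "\<And>x y. x \<in> {0..T} \<Longrightarrow> y \<in> {0..T} \<Longrightarrow> dist x y < \<delta> \<Longrightarrow> dist (E x) (E y) < b"
    unfolding uniformly_continuous_on_def using b_pos by metis
  obtain n where n_large: "T < real n * \<delta>"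
    using reals_Archimedean3[OF modulus(1)] by blast
  let ?n = "max n (count_hits E b T)"
  have "real n * \<delta> \<le> real ?n * \<delta>"
    using modulus(1) by (intro mult_right_mono) auto
  then have "off \<epsilon> ?n = T" if "0 < \<epsilon>" for \<epsilon>
    using n_large modulus(2)
    by (intro switching_path.off_eq_T[OF switching_path_at[OF that], of \<delta>])
        (force simp: dist_real_def not_less[symmetric])+
  then have "eventually (\<lambda>\<epsilon>. pairing (\<sigma> \<epsilon>) \<phi> = (\<Sum>k<?n. burst \<epsilon> \<phi> k)) (at_right 0)"
    using switching_path.pairing_eq_sum_bursts[OF switching_path_at \<phi>_continuous]
    by (intro eventually_mono[OF eventually_at_right_less]) auto
  then show ?thesis
    by (intro that[of ?n]) auto
qed

lemma pairing_tendsto: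
  assumes \<phi>_continuous: "continuous_on UNIV \<phi>"
  shows "((\<lambda>\<epsilon>. pairing (\<sigma> \<epsilon>) \<phi>) \<longlongrightarrow> impulse_pairing b T E \<phi>) (at_right 0)"
proof -
  obtain n where n_ge: "count_hits E b T \<le> n"
    and pairing_eq: "eventually (\<lambda>\<epsilon>. pairing (\<sigma> \<epsilon>) \<phi> = (\<Sum>k<n. burst \<epsilon> \<phi> k)) (at_right 0)"
    using eventually_pairing_eq_sum_bursts[OF \<phi>_continuous] .
  have burst_limit: "((\<lambda>\<epsilon>. burst \<epsilon> \<phi> k)
      \<longlongrightarrow> (if k < count_hits E b T then b * \<phi> (\<tau> (Suc k)) else 0)) (at_right 0)" for k
  proof -
    have "Suc k \<in> {k. 1 \<le> k \<and> \<tau> k \<le> T} \<longleftrightarrow> Suc k \<in> {1..count_hits E b T}"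
      by (simp only: hits_eq_Icc)
    then have "\<tau> (Suc k) \<le> T \<longleftrightarrow> k < count_hits E b T"
      by (simp add: Suc_le_eq)
    then show ?thesis
      using tau_neq_T[of "Suc k"] burst_tendsto[OF \<phi>_continuous, of k] burst_tendsto_0[of k \<phi>]
      by auto
  qed
  have "(\<Sum>k<n. if k < count_hits E b T then b * \<phi> (\<tau> (Suc k)) else 0)
      = (\<Sum>k<count_hits E b T. b * \<phi> (\<tau> (Suc k)))"
    using n_ge by (intro sum.mono_neutral_cong_right) auto
  also have "\<dots> = impulse_pairing b T E \<phi>"
    unfolding impulse_pairing_def \<tau>_def sum_distrib_left
    by (rule sum.reindex_bij_witness[where i = "\<lambda>i. i - 1" and j = Suc]) auto
  finally have limit: "(\<Sum>k<n. if k < count_hits E b T then b * \<phi> (\<tau> (Suc k)) else 0)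
      = impulse_pairing b T E \<phi>" .
  show ?thesis
    unfolding tendsto_cong[OF pairing_eq] limit[symmetric] by (intro tendsto_sum burst_limit)
qed

end

section \<open>Measure-theoretic tools\<close>

lemma ex_simple_minorant:
  assumes "(\<integral>\<^sup>+x. f x \<partial>M) < \<infinity>" "0 < e"
  obtains g where "simple_function M g" "g \<le> f" "(\<integral>\<^sup>+x. f x \<partial>M) \<le> (\<integral>\<^sup>+x. g x \<partial>M) + ennreal e"
proof -
  let ?A = "{g. simple_function M g \<and> g \<le> f}"
  have "(\<lambda>_. 0) \<in> ?A"
    by (simp add: le_fun_def)
  then have "?A \<noteq> {}"
    by blast
  from SUP_approx_ennreal[OF assms(2) this nn_integral_def]
  obtain g where "g \<in> ?A" "(\<integral>\<^sup>+x. f x \<partial>M) < integral\<^sup>S M g + ennreal e"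
    using assms(1) by (auto simp: less_top)
  then show ?thesis
    by (intro that[of g]) (auto simp: nn_integral_eq_simple_integral)
qed

text \<open>No measurability of the \<open>f n\<close> is assumed: the nonnegative integral is a lower integral, so
  it suffices to apply dominated convergence to almost optimal simple minorants.\<close>

lemma nn_integral_dominated_tendsto_0:
  fixes f :: "nat \<Rightarrow> 'a \<Rightarrow> ennreal"
  assumes [measurable]: "G \<in> borel_measurable M" and G_finite: "(\<integral>\<^sup>+x. G x \<partial>M) < \<infinity>"
    and dominated: "\<And>n. AE x in M. f n x \<le> G x"
    and limit: "AE x in M. (\<lambda>n. f n x) \<longlonglongrightarrow> 0"
  shows "(\<lambda>n. \<integral>\<^sup>+x. f n x \<partial>M) \<longlonglongrightarrow> 0"
proof -
  have "(\<integral>\<^sup>+x. f n x \<partial>M) < \<infinity>" for n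
    using nn_integral_mono_AE[OF dominated[of n]] G_finite by (rule order_le_less_trans)
  then have "\<exists>g. simple_function M g \<and> g \<le> f n \<and>
      (\<integral>\<^sup>+x. f n x \<partial>M) \<le> (\<integral>\<^sup>+x. g x \<partial>M) + ennreal (1 / real (Suc n))" for n
    using ex_simple_minorant[of M "f n" "1 / real (Suc n)"] by auto
  then obtain g where simple: "\<And>n. simple_function M (g n)" and g_le: "\<And>n x. g n x \<le> f n x"
    and approx: "\<And>n. (\<integral>\<^sup>+x. f n x \<partial>M) \<le> (\<integral>\<^sup>+x. g n x \<partial>M) + ennreal (1 / real (Suc n))"
    unfolding le_fun_def by metis
  have "(\<lambda>n. \<integral>\<^sup>+x. g n x \<partial>M) \<longlonglongrightarrow> (\<integral>\<^sup>+x. 0 \<partial>M)"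
  proof (rule nn_integral_dominated_convergence[where w = G])
    show "AE x in M. g n x \<le> G x" for n
      using dominated[of n] by eventually_elim (use g_le[of n] order_trans in blast)
    show "AE x in M. (\<lambda>n. g n x) \<longlonglongrightarrow> 0"
      using limit by eventually_elim (rule tendsto_sandwich[OF _ _ tendsto_const]; simp add: g_le)
  qed (use simple G_finite in \<open>auto intro: borel_measurable_simple_function\<close>)
  then have upper: "(\<lambda>n. (\<integral>\<^sup>+x. g n x \<partial>M) + ennreal (1 / real (Suc n))) \<longlonglongrightarrow> 0 + ennreal 0"
    by (intro tendsto_add tendsto_ennrealI LIMSEQ_Suc[OF lim_1_over_n]) simp
  show ?thesis
    by (rule tendsto_sandwich[OF _ _ tendsto_const upper[simplified]])
      (simp, intro always_eventually allI approx[simplified])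
qed

lemma nn_integral_dominated_at_right_tendsto_0:
  fixes f :: "real \<Rightarrow> 'a \<Rightarrow> ennreal"
  assumes "G \<in> borel_measurable M" "(\<integral>\<^sup>+x. G x \<partial>M) < \<infinity>"
    and dominated: "\<And>\<epsilon>. a < \<epsilon> \<Longrightarrow> AE x in M. f \<epsilon> x \<le> G x"
    and limit: "AE x in M. ((\<lambda>\<epsilon>. f \<epsilon> x) \<longlongrightarrow> 0) (at_right a)"
  shows "((\<lambda>\<epsilon>. \<integral>\<^sup>+x. f \<epsilon> x \<partial>M) \<longlongrightarrow> 0) (at_right a)"
proof (rule tendsto_at_right_sequentially[of a "a + 1"])
  fix s assume sequence: "\<And>n. a < s n" "s \<longlonglongrightarrow> a"
  have "filterlim s (at_right a) sequentially"
    using sequence by (intro tendsto_imp_filterlim_at_right) auto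
  then have "AE x in M. (\<lambda>n. f (s n) x) \<longlonglongrightarrow> 0"
    using limit by (auto elim!: eventually_mono intro: filterlim_compose)
  with assms(1,2) dominated[OF sequence(1)] show "(\<lambda>n. \<integral>\<^sup>+x. f (s n) x \<partial>M) \<longlonglongrightarrow> 0"
    by (rule nn_integral_dominated_tendsto_0)
qed simp

lemma emeasure_eventually_le:
  assumes [measurable]: "\<And>n. A n \<in> sets M" and A_le: "\<And>n. emeasure M (A n) \<le> c"
  shows "emeasure M {x \<in> space M. \<forall>\<^sub>F n in sequentially. x \<in> A n} \<le> c"
proof -
  have "indicator {x \<in> space M. \<forall>\<^sub>F n in sequentially. x \<in> A n} x
      \<le> liminf (\<lambda>n. indicator (A n) x :: ennreal)" for x
    by (auto simp: indicator_def intro!: Liminf_bounded elim!: eventually_mono)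
  then have "emeasure M {x \<in> space M. \<forall>\<^sub>F n in sequentially. x \<in> A n}
      \<le> (\<integral>\<^sup>+x. liminf (\<lambda>n. indicator (A n) x) \<partial>M)"
    by (simp add: nn_integral_mono flip: nn_integral_indicator)
  also have "\<dots> \<le> liminf (\<lambda>n. \<integral>\<^sup>+x. indicator (A n) x \<partial>M)"
    by (rule nn_integral_liminf) measurable
  also have "\<dots> \<le> c"
    using A_le by (intro Liminf_le) (auto simp: nn_integral_indicator)
  finally show ?thesis .
qed

lemma AE_limit_neq:
  fixes X :: "nat \<Rightarrow> 'a \<Rightarrow> real"
  assumes [measurable]: "\<And>n. X n \<in> borel_measurable M"
    and limit: "AE x in M. (\<lambda>n. X n x) \<longlonglongrightarrow> Y x"
    and small_ball: "\<And>n \<eta>. 0 < \<eta> \<Longrightarrow> emeasure M {x \<in> space M. \<bar>X n x - a\<bar> \<le> \<eta>} \<le> ennreal (c * \<eta>)"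
  shows "AE x in M. Y x \<noteq> a"
proof -
  define A where "A \<eta> n = {x \<in> space M. \<bar>X n x - a\<bar> \<le> \<eta>}" for \<eta> n
  have [measurable]: "A \<eta> n \<in> sets M" for \<eta> n
    unfolding A_def by measurable
  define N where "N = {x \<in> space M. \<forall>p. \<forall>\<^sub>F n in sequentially. x \<in> A (1 / real (Suc p)) n}"
  have "emeasure M N \<le> ennreal (c * (1 / real (Suc p)))" for p
  proof -
    have "emeasure M N
        \<le> emeasure M {x \<in> space M. \<forall>\<^sub>F n in sequentially. x \<in> A (1 / real (Suc p)) n}"
      by (intro emeasure_mono) (auto simp: N_def)
    also have "\<dots> \<le> ennreal (c * (1 / real (Suc p)))"
      using small_ball[of "1 / real (Suc p)"]
      by (intro emeasure_eventually_le) (simp_all add: A_def)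
    finally show ?thesis .
  qed
  moreover have "(\<lambda>p. ennreal (c * (1 / real (Suc p)))) \<longlonglongrightarrow> ennreal (c * 0)"
    by (intro tendsto_ennrealI tendsto_intros LIMSEQ_Suc[OF lim_1_over_n])
  ultimately have "emeasure M N \<le> ennreal (c * 0)"
    by (intro LIMSEQ_le_const) auto
  moreover have "N \<in> sets M"
    unfolding N_def by measurable
  ultimately have "AE x in M. x \<notin> N"
    by (intro AE_not_in) (auto simp: null_sets_def)
  with limit AE_space show ?thesis
  proof eventually_elim
    case (elim x)
    have "\<forall>\<^sub>F n in sequentially. x \<in> A (1 / real (Suc p)) n" if "Y x = a" for p
      using elim(1,2) that tendstoD[of "\<lambda>n. X n x" a sequentially "1 / real (Suc p)"]
      by (auto simp: A_def dist_real_def elim!: eventually_mono)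
    then show ?case
      using elim(2,3) by (auto simp: N_def)
  qed
qed

lemma emeasure_vimage_Icc_le:
  assumes X_density: "distributed M lborel X (\<lambda>x. ennreal (f x))"
    and density_le: "\<And>x. f x \<le> \<kappa>" "0 \<le> \<kappa>" and "u \<le> v"
  shows "emeasure M (X -` {u..v} \<inter> space M) \<le> ennreal (\<kappa> * (v - u))"
proof -
  have "emeasure M (X -` {u..v} \<inter> space M) = (\<integral>\<^sup>+x. ennreal (f x) * indicator {u..v} x \<partial>lborel)"
    by (rule distributed_emeasure[OF X_density]) simp
  also have "\<dots> \<le> (\<integral>\<^sup>+x. ennreal \<kappa> * indicator {u..v} x \<partial>lborel)"
    using density_le(1) by (intro nn_integral_mono mult_right_mono ennreal_leI) auto
  also have "\<dots> = ennreal (\<kappa> * (v - u))"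
    using assms(3,4) by (simp add: nn_integral_cmult_indicator ennreal_mult)
  finally show ?thesis .
qed

lemma (in prob_space) emeasure_indep_sum_small_ball:
  fixes X Y :: "'a \<Rightarrow> real"
  assumes indep: "indep_var borel X borel Y"
    and X_density: "distributed M lborel X (\<lambda>x. ennreal (f x))"
    and density_le: "\<And>x. f x \<le> \<kappa>" "0 \<le> \<kappa>" and \<eta>_nonneg: "0 \<le> \<eta>"
  shows "emeasure M {\<omega> \<in> space M. \<bar>X \<omega> + Y \<omega> - a\<bar> \<le> \<eta>} \<le> ennreal (\<kappa> * (2 * \<eta>))"
proof -
  have [measurable]: "X \<in> borel_measurable M" "Y \<in> borel_measurable M"
    using indep_var_rv1[OF indep] indep_var_rv2[OF indep] by auto
  interpret X: prob_space "distr M borel X" by (rule prob_space_distr) simp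
  interpret Y: prob_space "distr M borel Y" by (rule prob_space_distr) simp
  interpret pair_sigma_finite "distr M borel X" "distr M borel Y" ..
  define S where "S = {p \<in> space (borel \<Otimes>\<^sub>M borel). \<bar>fst p + snd p - a\<bar> \<le> \<eta>}"
  have S_measurable[measurable]: "S \<in> sets (borel \<Otimes>\<^sub>M borel)"
    unfolding S_def by measurable
  have "{\<omega> \<in> space M. \<bar>X \<omega> + Y \<omega> - a\<bar> \<le> \<eta>} = (\<lambda>\<omega>. (X \<omega>, Y \<omega>)) -` S \<inter> space M"
    by (auto simp: S_def space_pair_measure)
  then have "emeasure M {\<omega> \<in> space M. \<bar>X \<omega> + Y \<omega> - a\<bar> \<le> \<eta>}
      = emeasure (distr M (borel \<Otimes>\<^sub>M borel) (\<lambda>\<omega>. (X \<omega>, Y \<omega>))) S"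
    by (simp add: emeasure_distr)
  also have "\<dots> = emeasure (distr M borel X \<Otimes>\<^sub>M distr M borel Y) S"
    using indep by (simp add: indep_var_distribution_eq)
  also have "\<dots> = (\<integral>\<^sup>+y. emeasure (distr M borel X) ((\<lambda>x. (x, y)) -` S) \<partial>distr M borel Y)"
    by (rule emeasure_pair_measure_alt2) (simp add: S_measurable cong: sets_pair_measure_cong)
  also have "\<dots> \<le> (\<integral>\<^sup>+y. ennreal (\<kappa> * (2 * \<eta>)) \<partial>distr M borel Y)"
  proof (rule nn_integral_mono)
    fix y
    have "(\<lambda>x. (x, y)) -` S = {a - y - \<eta>..a - y + \<eta>}"
      by (auto simp: S_def space_pair_measure abs_le_iff)
    then have "emeasure (distr M borel X) ((\<lambda>x. (x, y)) -` S)
        = emeasure M (X -` {a - y - \<eta>..a - y + \<eta>} \<inter> space M)"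
      by (simp add: emeasure_distr)
    also have "\<dots> \<le> ennreal (\<kappa> * (2 * \<eta>))"
      using emeasure_vimage_Icc_le[OF X_density density_le, of "a - y - \<eta>" "a - y + \<eta>"] \<eta>_nonneg
      by simp
    finally show "emeasure (distr M borel X) ((\<lambda>x. (x, y)) -` S) \<le> ennreal (\<kappa> * (2 * \<eta>))" .
  qed
  also have "\<dots> = ennreal (\<kappa> * (2 * \<eta>))"
    by (simp add: Y.emeasure_space_1[simplified])
  finally show ?thesis .
qed

lemma distributed_lborel_AE_neq:
  assumes X_density: "distributed M lborel X f"
  shows "AE x in M. X x \<noteq> a"
proof (rule AE_I')
  have "emeasure M (X -` {a} \<inter> space M) = (\<integral>\<^sup>+x. f x * indicator {a} x \<partial>lborel)"
    by (rule distributed_emeasure[OF X_density]) simp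
  also have "\<dots> = 0"
    by (simp add: nn_integral_0_iff_AE AE_I'[of "{a}"])
  finally show "X -` {a} \<inter> space M \<in> null_sets M"
    using measurable_sets[OF distributed_measurable[OF X_density], of "{a}"]
    by (simp add: null_sets_def)
qed auto

lemma normal_density_le:
  assumes "0 < \<sigma>"
  shows "normal_density \<mu> \<sigma> x \<le> 1 / sqrt (2 * pi * \<sigma>\<^sup>2)"
  using assms by (auto simp: normal_density_def intro!: divide_right_mono)

lemma (in prob_space) normal_deviation_prob_le:
  assumes X_normal: "distributed M lborel X (normal_density \<mu> \<sigma>)" and "0 < \<sigma>" "0 < c"
  shows "prob {\<omega> \<in> space M. c \<le> \<bar>X \<omega> - \<mu>\<bar>} \<le> \<sigma>\<^sup>2 / c\<^sup>2"
proof -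
  have [measurable]: "random_variable borel X"
    using distributed_measurable[OF X_normal] by simp
  have integrable: "integrable M (\<lambda>\<omega>. (X \<omega> - \<mu>)\<^sup>2)"
    using distributed_integrable[OF X_normal, of "\<lambda>x. (x - \<mu>)\<^sup>2"]
      integrable_normal_moment[OF \<open>0 < \<sigma>\<close>] by simp
  have "expectation (\<lambda>\<omega>. (X \<omega> - \<mu>)\<^sup>2) = \<sigma>\<^sup>2"
    using distributed_integral[OF X_normal, of "\<lambda>x. (x - \<mu>)\<^sup>2"]
      integral_normal_moment_even[OF \<open>0 < \<sigma>\<close>, of \<mu> 1]
    by (simp add: fact_numeral)
  then show ?thesis
    using second_moment_method[OF _ integrable \<open>0 < c\<close>] by simp
qed

lemma nn_integral_normal_even_moment:
  assumes X_normal: "distributed M lborel X (normal_density \<mu> \<sigma>)" and "0 < \<sigma>"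
  shows "(\<integral>\<^sup>+\<omega>. ennreal ((X \<omega> - \<mu>) ^ (2 * k)) \<partial>M)
      = ennreal (fact (2 * k) / (2 ^ k * fact k) * \<sigma> ^ (2 * k))"
proof -
  have nonneg: "0 \<le> (x - \<mu>) ^ (2 * k)" for x
    by (simp add: power_mult)
  have "(\<integral>\<^sup>+\<omega>. ennreal ((X \<omega> - \<mu>) ^ (2 * k)) \<partial>M)
      = (\<integral>\<^sup>+x. ennreal (normal_density \<mu> \<sigma> x) * ennreal ((x - \<mu>) ^ (2 * k)) \<partial>lborel)"
    by (rule distributed_nn_integral[OF X_normal, symmetric]) simp
  also have "\<dots> = (\<integral>\<^sup>+x. ennreal (normal_density \<mu> \<sigma> x * (x - \<mu>) ^ (2 * k)) \<partial>lborel)"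
    using nonneg by (simp add: ennreal_mult)
  also have "\<dots> = ennreal (fact (2 * k) / ((2 / \<sigma>\<^sup>2) ^ k * fact k))"
    using normal_moment_even[OF \<open>0 < \<sigma>\<close>, of \<mu> k] nonneg
    by (subst nn_integral_eq_integral) (auto simp: has_bochner_integral_iff)
  also have "fact (2 * k) / ((2 / \<sigma>\<^sup>2) ^ k * fact k)
      = fact (2 * k) / (2 ^ k * fact k) * \<sigma> ^ (2 * k)"
    by (simp add: power_divide power_mult)
  finally show ?thesis .
qed

lemma grid_point_in_Icc:
  fixes s t :: real
  assumes "s \<le> t" "j \<le> Suc n"
  shows "s + real j * ((t - s) / real (Suc n)) \<in> {s..t}"
proof -
  have "real j * ((t - s) / real (Suc n)) \<le> real (Suc n) * ((t - s) / real (Suc n))"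
    using assms by (intro mult_right_mono) auto
  also have "\<dots> = t - s"
    by simp
  finally show ?thesis
    using assms(1) by simp
qed

lemma grid_points_dense:
  fixes s t x :: real
  assumes "s < t" "x \<in> {s..t}"
  obtains j where "\<And>n. j n \<le> Suc n" "(\<lambda>n. s + real (j n) * ((t - s) / real (Suc n))) \<longlonglongrightarrow> x"
proof -
  define h where "h n = (t - s) / real (Suc n)" for n
  have step: "0 < h n" "real (Suc n) * h n = t - s" for n
    using assms(1) by (simp_all add: h_def)
  define j where "j n = nat \<lfloor>(x - s) / h n\<rfloor>" for n
  have index_bounds: "real (j n) * h n \<le> x - s" "x - s < (real (j n) + 1) * h n" for n
    using assms(2) step(1)[of n]
    by (simp_all add: j_def pos_le_divide_eq[symmetric] pos_divide_less_eq[symmetric])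
  have "j n \<le> Suc n" for n
  proof -
    have "real (j n) * h n \<le> real (Suc n) * h n"
      using index_bounds(1)[of n] step(2)[of n] assms(2) by simp
    then show ?thesis
      using step(1)[of n] by (simp only: mult_le_cancel_right) simp
  qed
  moreover have "(\<lambda>n. s + real (j n) * h n) \<longlonglongrightarrow> x"
  proof (rule tendsto_sandwich)
    have "x - h n \<le> s + real (j n) * h n" "s + real (j n) * h n \<le> x" for n
      using index_bounds[of n] by (simp_all add: distrib_right)
    then show "\<forall>\<^sub>F n in sequentially. x - h n \<le> s + real (j n) * h n"
      "\<forall>\<^sub>F n in sequentially. s + real (j n) * h n \<le> x"
      by simp_all
    have "h \<longlonglongrightarrow> (t - s) * 0"
      unfolding h_def[abs_def] divide_inverse by (intro tendsto_intros LIMSEQ_inverse_real_of_nat)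
    from tendsto_diff[OF tendsto_const this] show "(\<lambda>n. x - h n) \<longlonglongrightarrow> x"
      by simp
  qed simp
  ultimately show ?thesis
    using that unfolding h_def by blast
qed

lemma grid_Max_tendsto_SUP:
  fixes f :: "real \<Rightarrow> real"
  assumes f_continuous: "continuous_on {s..t} f" and "s < t"
  shows "(\<lambda>n. Max ((\<lambda>j. f (s + real j * ((t - s) / real (Suc n)))) ` {..Suc n}))
      \<longlonglongrightarrow> (SUP x\<in>{s..t}. f x)"
    (is "?Max \<longlonglongrightarrow> _")
proof -
  have grid_in: "s + real j * ((t - s) / real (Suc n)) \<in> {s..t}" if "j \<le> Suc n" for j n
    using grid_point_in_Icc[OF _ that] \<open>s < t\<close> by simp
  obtain x where maximizer: "x \<in> {s..t}" "\<And>y. y \<in> {s..t} \<Longrightarrow> f y \<le> f x"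
    using continuous_attains_sup[OF _ _ f_continuous] \<open>s < t\<close> by auto
  obtain j where approximating: "\<And>n. j n \<le> Suc n"
    "(\<lambda>n. s + real (j n) * ((t - s) / real (Suc n))) \<longlonglongrightarrow> x"
    using grid_points_dense[OF \<open>s < t\<close> maximizer(1)] by blast
  have "?Max \<longlonglongrightarrow> f x"
  proof (rule tendsto_sandwich)
    have "f (s + real (j n) * ((t - s) / real (Suc n))) \<le> ?Max n" for n
      using approximating(1) by (intro Max_ge) auto
    then show "\<forall>\<^sub>F n in sequentially. f (s + real (j n) * ((t - s) / real (Suc n))) \<le> ?Max n"
      by (rule always_eventually[OF allI])
    have "?Max n \<le> f x" for n
      using grid_in maximizer(2) by (intro Max.boundedI) auto
    then show "\<forall>\<^sub>F n in sequentially. ?Max n \<le> f x"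
      by (rule always_eventually[OF allI])
    show "(\<lambda>n. f (s + real (j n) * ((t - s) / real (Suc n)))) \<longlonglongrightarrow> f x"
      using maximizer(1) grid_in[OF approximating(1)]
      by (intro continuous_on_tendsto_compose[OF f_continuous approximating(2)]) auto
  qed simp
  also have "f x = (SUP x\<in>{s..t}. f x)"
    using maximizer by (intro cSup_eq_maximum[symmetric]) auto
  finally show ?thesis .
qed

section \<open>Brownian motion\<close>

locale brownian =
  fixes M :: "'a measure" and W :: "real \<Rightarrow> 'a \<Rightarrow> real"
  assumes brownian_motion: "brownian_motion M W"

sublocale brownian \<subseteq> prob_space M
  using brownian_motion by (simp add: brownian_motion_def)

context brownian
begin

lemma W_0: "\<omega> \<in> space M \<Longrightarrow> W 0 \<omega> = 0"
  and W_continuous: "\<omega> \<in> space M \<Longrightarrow> continuous_on {0..} (\<lambda>t. W t \<omega>)"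
  using brownian_motion by (auto simp: brownian_motion_def)

lemma increment_distributed:
  "0 \<le> s \<Longrightarrow> s < t \<Longrightarrow> distributed M lborel (\<lambda>\<omega>. W t \<omega> - W s \<omega>) (normal_density 0 (sqrt (t - s)))"
  using brownian_motion by (auto simp: brownian_motion_def)

lemma increments_indep:
  "0 \<le> ts 0 \<Longrightarrow> strict_mono ts \<Longrightarrow>
    indep_vars (\<lambda>_. borel) (\<lambda>i \<omega>. W (ts (Suc i)) \<omega> - W (ts i) \<omega>) {..<n}"
  using brownian_motion by (auto simp: brownian_motion_def)

lemma W_measurable [measurable]:
  assumes "0 \<le> t"
  shows "W t \<in> borel_measurable M"
proof (cases "t = 0")
  case True
  then show ?thesis
    using W_0 by (subst measurable_cong[where g = "\<lambda>_. 0"]) auto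
next
  case False
  then have "(\<lambda>\<omega>. W t \<omega> - W 0 \<omega>) \<in> borel_measurable M"
    using distributed_measurable[OF increment_distributed[of 0 t]] assms by simp
  then show ?thesis
    using W_0 by (subst measurable_cong[where g = "\<lambda>\<omega>. W t \<omega> - W 0 \<omega>"]) auto
qed

lemma kolmogorov_chentsov_rescaled:
  assumes L_pos: "0 < L" and exponent: "0 < \<gamma>" "\<gamma> * real (2 * k) < real k - 1"
  shows "kolmogorov_chentsov M (\<lambda>t. W (L * t)) (2 * k)
    (fact (2 * k) / (2 ^ k * fact k) * L ^ k) (real k - 1) \<gamma>"
proof
  show "W (L * t) \<in> borel_measurable M" if "t \<in> {0..1}" for t
    using L_pos that by simp
  show "continuous_on {0..1} (\<lambda>t. W (L * t) \<omega>)" if "\<omega> \<in> space M" for \<omega>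
    using L_pos by (intro continuous_on_compose2[OF W_continuous[OF that]] continuous_intros) auto
  fix s t :: real assume times: "0 \<le> s" "s < t" "t \<le> 1"
  have "(\<integral>\<^sup>+\<omega>. ennreal (\<bar>W (L * t) \<omega> - W (L * s) \<omega>\<bar> ^ (2 * k)) \<partial>M)
      = (\<integral>\<^sup>+\<omega>. ennreal ((W (L * t) \<omega> - W (L * s) \<omega> - 0) ^ (2 * k)) \<partial>M)"
    by (simp add: power_mult)
  also have "\<dots> = ennreal (fact (2 * k) / (2 ^ k * fact k) * sqrt (L * t - L * s) ^ (2 * k))"
    using L_pos times by (intro nn_integral_normal_even_moment increment_distributed) auto
  also have "sqrt (L * t - L * s) ^ (2 * k) = (L * t - L * s) ^ k"
    using L_pos times unfolding power_mult by simp
  also have "\<dots> = L ^ k * (t - s) ^ k"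
    by (simp add: power_mult_distrib flip: right_diff_distrib)
  also have "(t - s) ^ k = (t - s) powr (1 + (real k - 1))"
    using times by (simp add: powr_realpow)
  finally show "(\<integral>\<^sup>+\<omega>. ennreal (\<bar>W (L * t) \<omega> - W (L * s) \<omega>\<bar> ^ (2 * k)) \<partial>M)
      \<le> ennreal (fact (2 * k) / (2 ^ k * fact k) * L ^ k * (t - s) powr (1 + (real k - 1)))"
    by (simp add: mult.assoc)
next
  show "0 < 2 * k"
    using exponent by (cases k) auto
qed (use assms in auto)

lemma W_hoelder:
  assumes exponent: "0 < \<gamma>" "\<gamma> * real (2 * k) < real k - 1"
  obtains K where "K \<in> borel_measurable M" "\<And>\<omega>. 1 \<le> K \<omega>" "(\<integral>\<^sup>+\<omega>. ennreal (K \<omega> ^ (2 * k)) \<partial>M) < \<infinity>"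
    "AE \<omega> in M. hoelder_on \<gamma> (K \<omega>) {0..T} (\<lambda>t. W t \<omega>)"
proof -
  define L where "L = max 1 T"
  have L_bounds: "0 < L" "T \<le> L"
    by (auto simp: L_def)
  interpret kolmogorov_chentsov M "\<lambda>t. W (L * t)" "2 * k"
    "fact (2 * k) / (2 ^ k * fact k) * L ^ k" "real k - 1" \<gamma>
    using L_bounds(1) exponent by (rule kolmogorov_chentsov_rescaled)
  obtain H where H_hoelder: "H \<in> borel_measurable M" "\<And>\<omega>. 0 \<le> H \<omega>"
    "(\<integral>\<^sup>+\<omega>. ennreal (H \<omega> ^ (2 * k)) \<partial>M) < \<infinity>"
    "AE \<omega> in M. hoelder_on \<gamma> (H \<omega>) {0..1} (\<lambda>t. W (L * t) \<omega>)"
    using paths_hoelder by blast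
  note [measurable] = H_hoelder(1)
  let ?c = "L powr \<gamma>"
  have "1 \<le> ?c"
    using exponent(1) ge_one_powr_ge_zero[of L \<gamma>] by (simp add: L_def)
  let ?K = "\<lambda>\<omega>. max 1 (H \<omega>)"
  show ?thesis
  proof (rule that[of ?K])
    have "(\<integral>\<^sup>+\<omega>. ennreal (?K \<omega> ^ (2 * k)) \<partial>M) \<le> (\<integral>\<^sup>+\<omega>. 1 + ennreal (H \<omega> ^ (2 * k)) \<partial>M)"
      by (intro nn_integral_mono) (auto simp: max_def)
    also have "\<dots> = 1 + (\<integral>\<^sup>+\<omega>. ennreal (H \<omega> ^ (2 * k)) \<partial>M)"
      by (subst nn_integral_add) (auto simp: emeasure_space_1)
    finally show "(\<integral>\<^sup>+\<omega>. ennreal (?K \<omega> ^ (2 * k)) \<partial>M) < \<infinity>"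
      using H_hoelder(3) by (auto intro: order_le_less_trans)
    show "AE \<omega> in M. hoelder_on \<gamma> (?K \<omega>) {0..T} (\<lambda>t. W t \<omega>)"
      using H_hoelder(4)
    proof eventually_elim
      case (elim \<omega>)
      then have "hoelder_on \<gamma> (H \<omega> / ?c) {0..L} (\<lambda>t. W t \<omega>)"
        by (rule hoelder_on_rescale[OF L_bounds(1)])
      moreover have "H \<omega> / ?c \<le> H \<omega> / 1"
        using H_hoelder(2)[of \<omega>] \<open>1 \<le> ?c\<close> by (intro divide_left_mono) auto
      ultimately have "hoelder_on \<gamma> (?K \<omega>) {0..L} (\<lambda>t. W t \<omega>)"
        by (elim hoelder_on_mono) simp
      then show ?case
        by (rule hoelder_on_subset) (use L_bounds(2) in auto)
    qed
  qed auto
qed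

end

locale drifted_brownian = brownian M W
  for M :: "'a measure" and W :: "real \<Rightarrow> 'a \<Rightarrow> real" +
  fixes m D :: real
  assumes D_nonzero: "D \<noteq> 0"
begin

abbreviation E :: "'a \<Rightarrow> real \<Rightarrow> real" where
  "E \<omega> \<equiv> energy m D (\<lambda>t. W t \<omega>)"

lemma E_0: "\<omega> \<in> space M \<Longrightarrow> E \<omega> 0 = 0"
  by (simp add: energy_def W_0)

lemma E_continuous: "\<omega> \<in> space M \<Longrightarrow> continuous_on {0..} (E \<omega>)"
  unfolding energy_def by (intro continuous_intros W_continuous)

lemma E_eq_increment: "\<omega> \<in> space M \<Longrightarrow> E \<omega> t = m * t + D * (W t \<omega> - W 0 \<omega>)"
  by (simp add: energy_def W_0)

lemma E_measurable: "0 \<le> t \<Longrightarrow> (\<lambda>\<omega>. E \<omega> t) \<in> borel_measurable M"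
  unfolding energy_def by measurable

lemma affine_increment_distributed:
  assumes "0 < t"
  shows "distributed M lborel (\<lambda>\<omega>. m * t + D * (W t \<omega> - W 0 \<omega>))
    (normal_density (m * t) (\<bar>D\<bar> * sqrt t))"
  using normal_density_affine[OF increment_distributed[of 0 t], of D "m * t"] assms D_nonzero
  by simp

lemma AE_E_neq:
  assumes "0 < t"
  shows "AE \<omega> in M. E \<omega> t \<noteq> a"
  using distributed_lborel_AE_neq[OF affine_increment_distributed[OF assms], of a] AE_space
  by eventually_elim (simp add: E_eq_increment)

lemma prob_E_less_le:
  assumes "0 < t" "a < m * t"
  shows "prob {\<omega> \<in> space M. E \<omega> t < a} \<le> D\<^sup>2 * t / (m * t - a)\<^sup>2"
proof -
  let ?X = "\<lambda>\<omega>. m * t + D * (W t \<omega> - W 0 \<omega>)"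
  note distributed = affine_increment_distributed[OF assms(1)]
  have [measurable]: "W t \<in> borel_measurable M" "W 0 \<in> borel_measurable M"
    using assms(1) by (auto intro: W_measurable)
  have "{\<omega> \<in> space M. m * t - a \<le> \<bar>?X \<omega> - m * t\<bar>} \<in> events"
    by measurable
  then have "prob {\<omega> \<in> space M. E \<omega> t < a} \<le> prob {\<omega> \<in> space M. m * t - a \<le> \<bar>?X \<omega> - m * t\<bar>}"
    by (intro finite_measure_mono) (auto simp: E_eq_increment)
  also have "\<dots> \<le> (\<bar>D\<bar> * sqrt t)\<^sup>2 / (m * t - a)\<^sup>2"
    using assms D_nonzero by (intro normal_deviation_prob_le[OF distributed]) auto
  also have "\<dots> = D\<^sup>2 * t / (m * t - a)\<^sup>2"
    using assms(1) by (simp add: power_mult_distrib)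
  finally show ?thesis .
qed

lemma AE_ex_E_ge:
  assumes "0 < m"
  shows "AE \<omega> in M. \<exists>n. a \<le> E \<omega> (real n)"
proof -
  let ?N = "{\<omega> \<in> space M. \<forall>n. E \<omega> (real n) < a}"
  note [measurable] = E_measurable
  have "(\<lambda>n. D\<^sup>2 * real n / (m * real n - a)\<^sup>2) \<longlonglongrightarrow> 0"
    using assms by real_asymp
  moreover have "eventually (\<lambda>n. prob ?N \<le> D\<^sup>2 * real n / (m * real n - a)\<^sup>2) sequentially"
  proof -
    have "eventually (\<lambda>n. a < m * real n) sequentially"
      using assms by real_asymp
    with eventually_gt_at_top[of 0] show ?thesis
    proof eventually_elim
      case (elim n)
      have "prob ?N \<le> prob {\<omega> \<in> space M. E \<omega> (real n) < a}"
        by (intro finite_measure_mono) auto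
      then show ?case
        using prob_E_less_le[of "real n" a] elim by simp
    qed
  qed
  ultimately have "prob ?N \<le> 0"
    by (intro tendsto_lowerbound) auto
  then have "?N \<in> null_sets M"
    by (auto simp: null_sets_def emeasure_eq_measure intro: antisym)
  then show ?thesis
    by (rule AE_I') (auto simp: not_le)
qed

lemma AE_level_hit:
  assumes "0 < m" "0 < a"
  shows "AE \<omega> in M. \<exists>t>0. E \<omega> t = a"
  using AE_ex_E_ge[OF assms(1), of a] AE_space
proof eventually_elim
  case (elim \<omega>)
  then obtain n where reached: "a \<le> E \<omega> (real n)"
    by blast
  have "continuous_on {0..real n} (E \<omega>)"
    using elim(2) by (intro continuous_on_subset[OF E_continuous]) auto
  then obtain t where "0 \<le> t" "E \<omega> t = a"
    using IVT'[of "E \<omega>" 0 a "real n"] reached assms(2) E_0[OF elim(2)] by auto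
  then show ?case
    using assms(2) E_0[OF elim(2)] by (intro exI[of _ t]) (auto simp: less_le)
qed

lemma indep_var_increment_grid_Max:
  assumes positive: "0 < s" "0 < h"
  shows "indep_var borel (\<lambda>\<omega>. W s \<omega> - W 0 \<omega>)
    borel (\<lambda>\<omega>. Max ((\<lambda>j. E \<omega> (s + real j * h) - E \<omega> s) ` {..n}))"
proof -
  define ts where "ts i = (case i of 0 \<Rightarrow> 0 | Suc j \<Rightarrow> s + real j * h)" for i :: nat
  have ts_simps: "ts 0 = 0" "ts (Suc j) = s + real j * h" for j
    by (simp_all add: ts_def)
  define X where "X i \<omega> = W (ts (Suc i)) \<omega> - W (ts i) \<omega>" for i \<omega>
  have "strict_mono ts"
    unfolding strict_mono_Suc_iff using positive
    by (auto simp: ts_def distrib_right split: nat.split)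
  then have indep: "indep_vars (\<lambda>_. borel) X {..<Suc n}"
    unfolding X_def[abs_def] by (intro increments_indep) (auto simp: ts_simps)
  define F where "F x = Max ((\<lambda>j. m * (real j * h) + D * (\<Sum>i\<in>{1..j}. x i)) ` {..n})"
    for x :: "nat \<Rightarrow> real"
  have F_measurable: "F \<in> borel_measurable (Pi\<^sub>M {1..n} (\<lambda>_. borel))"
    unfolding F_def
    by (intro borel_measurable_Max borel_measurable_add borel_measurable_times
        borel_measurable_const borel_measurable_sum measurable_component_singleton) auto
  have "indep_var borel ((\<lambda>x. x 0) \<circ> (\<lambda>\<omega>. restrict (\<lambda>i. X i \<omega>) {0}))
      borel (F \<circ> (\<lambda>\<omega>. restrict (\<lambda>i. X i \<omega>) {1..n}))"
    by (rule indep_var_compose[OF indep_var_restrict[OF indep, of "{0}" "{1..n}"] _ F_measurable])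
      (auto intro: measurable_component_singleton)
  moreover have "(\<lambda>x. x 0) \<circ> (\<lambda>\<omega>. restrict (\<lambda>i. X i \<omega>) {0}) = (\<lambda>\<omega>. W s \<omega> - W 0 \<omega>)"
    by (auto simp: X_def ts_simps fun_eq_iff)
  moreover have "F (restrict (\<lambda>i. X i \<omega>) {1..n})
      = Max ((\<lambda>j. E \<omega> (s + real j * h) - E \<omega> s) ` {..n})" for \<omega>
    unfolding F_def
  proof (intro arg_cong[where f = Max] image_cong refl)
    fix j assume "j \<in> {..n}"
    then have "(\<Sum>i\<in>{1..j}. restrict (\<lambda>i. X i \<omega>) {1..n} i) = (\<Sum>i\<in>{1..j}. X i \<omega>)"
      by (intro sum.cong) auto
    also have "\<dots> = W (s + real j * h) \<omega> - W s \<omega>"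
      by (induction j) (auto simp: X_def ts_simps)
    finally show "m * (real j * h) + D * (\<Sum>i\<in>{1..j}. restrict (\<lambda>i. X i \<omega>) {1..n} i)
        = E \<omega> (s + real j * h) - E \<omega> s"
      by (simp only:) (simp add: energy_def algebra_simps)
  qed
  ultimately show ?thesis
    by (simp add: comp_def)
qed

lemma grid_Max_small_ball:
  assumes positive: "0 < s" "0 < h" and \<eta>_nonneg: "0 \<le> \<eta>"
  shows "emeasure M {\<omega> \<in> space M. \<bar>Max ((\<lambda>j. E \<omega> (s + real j * h)) ` {..n}) - a\<bar> \<le> \<eta>}
    \<le> ennreal (1 / sqrt (2 * pi * (\<bar>D\<bar> * sqrt s)\<^sup>2) * (2 * \<eta>))"
proof -
  let ?X = "\<lambda>\<omega>. m * s + D * (W s \<omega> - W 0 \<omega>)"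
  let ?Y = "\<lambda>\<omega>. Max ((\<lambda>j. E \<omega> (s + real j * h) - E \<omega> s) ` {..n})"
  have "indep_var borel ((\<lambda>x. m * s + D * x) \<circ> (\<lambda>\<omega>. W s \<omega> - W 0 \<omega>)) borel ((\<lambda>x. x) \<circ> ?Y)"
    by (rule indep_var_compose[OF indep_var_increment_grid_Max[OF positive]]) auto
  then have indep: "indep_var borel ?X borel ?Y"
    by (simp add: comp_def)
  have "Max ((\<lambda>j. E \<omega> (s + real j * h)) ` {..n}) = ?X \<omega> + ?Y \<omega>" if "\<omega> \<in> space M" for \<omega>
    using Max_add_commute[of "{..n}" "\<lambda>j. E \<omega> (s + real j * h) - E \<omega> s" "E \<omega> s"]
    by (simp add: E_eq_increment[OF that, of s, symmetric])
  then have "{\<omega> \<in> space M. \<bar>Max ((\<lambda>j. E \<omega> (s + real j * h)) ` {..n}) - a\<bar> \<le> \<eta>}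
      = {\<omega> \<in> space M. \<bar>?X \<omega> + ?Y \<omega> - a\<bar> \<le> \<eta>}"
    by (intro Collect_cong conj_cong refl) simp
  moreover have "emeasure M {\<omega> \<in> space M. \<bar>?X \<omega> + ?Y \<omega> - a\<bar> \<le> \<eta>}
      \<le> ennreal (1 / sqrt (2 * pi * (\<bar>D\<bar> * sqrt s)\<^sup>2) * (2 * \<eta>))"
    by (rule emeasure_indep_sum_small_ball[OF indep affine_increment_distributed[OF positive(1)]
        normal_density_le _ \<eta>_nonneg])
      (use positive(1) D_nonzero in auto)
  ultimately show ?thesis
    by simp
qed

lemma AE_SUP_neq:
  assumes "0 < s" "s < t"
  shows "AE \<omega> in M. (SUP x\<in>{s..t}. E \<omega> x) \<noteq> a"
proof (rule AE_limit_neq)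
  let ?h = "\<lambda>n. (t - s) / real (Suc n)"
  show "(\<lambda>\<omega>. Max ((\<lambda>j. E \<omega> (s + real j * ?h n)) ` {..Suc n})) \<in> borel_measurable M" for n
    using assms by (intro borel_measurable_Max E_measurable) auto
  show "AE \<omega> in M. (\<lambda>n. Max ((\<lambda>j. E \<omega> (s + real j * ?h n)) ` {..Suc n})) \<longlonglongrightarrow> (SUP x\<in>{s..t}. E \<omega> x)"
    using AE_space
  proof eventually_elim
    case (elim \<omega>)
    have "continuous_on {s..t} (E \<omega>)"
      using assms by (intro continuous_on_subset[OF E_continuous[OF elim]]) auto
    then show ?case
      using assms(2) by (rule grid_Max_tendsto_SUP)
  qed
  show "emeasure M {\<omega> \<in> space M. \<bar>Max ((\<lambda>j. E \<omega> (s + real j * ?h n)) ` {..Suc n}) - a\<bar> \<le> \<eta>}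
      \<le> ennreal (2 / sqrt (2 * pi * (\<bar>D\<bar> * sqrt s)\<^sup>2) * \<eta>)" if "0 < \<eta>" for n \<eta>
    using grid_Max_small_ball[OF assms(1), of "?h n" \<eta> "Suc n" a] assms that by simp
qed

lemma AE_regular_energy_path:
  assumes m_pos: "0 < m" and b_pos: "0 < b" and T_nonneg: "0 \<le> T"
  shows "AE \<omega> in M. regular_energy_path (E \<omega>) b T"
proof -
  have "AE \<omega> in M. \<forall>k. 1 \<le> k \<longrightarrow> (\<exists>t>0. E \<omega> t = real k * b)"
    unfolding AE_all_countable using AE_level_hit[OF m_pos] b_pos by (auto intro!: AE_impI)
  moreover have "AE \<omega> in M. \<forall>k. 1 \<le> k \<longrightarrow> E \<omega> T \<noteq> real k * b"
  proof (cases "T = 0")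
    case True
    then show ?thesis
      using AE_space b_pos by (auto elim!: eventually_mono simp: E_0)
  next
    case False
    then show ?thesis
      unfolding AE_all_countable using AE_E_neq T_nonneg by (auto intro!: AE_impI)
  qed
  moreover have "AE \<omega> in M. \<forall>k s t. 0 < s \<and> s < t \<longrightarrow>
      (SUP x\<in>{real_of_rat s..real_of_rat t}. E \<omega> x) \<noteq> real k * b"
    unfolding AE_all_countable using AE_SUP_neq by (auto intro!: AE_impI simp: of_rat_less)
  ultimately show ?thesis
    using AE_space
  proof eventually_elim
    case (elim \<omega>)
    interpret energy_path "E \<omega>" b T
      using elim(1) b_pos T_nonneg E_continuous[OF elim(4)] E_0[OF elim(4)] by unfold_locales auto
    show ?case
    proof
      fix k :: nat assume k_ge_1: "1 \<le> k"
      show "E \<omega> T \<noteq> real k * b"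
        using elim(2) k_ge_1 by blast
      show "\<exists>u\<in>{\<tau> k<..<x}. real k * b < E \<omega> u" if "\<tau> k < x" for x
        using elim(3) levels_hit[OF k_ge_1] k_ge_1 b_pos that unfolding \<tau>_def
        by (intro ex_above_after_hit_time E_continuous E_0 elim(4)) auto
    qed
  qed
qed

end

section \<open>Mean-square convergence\<close>

lemma
  assumes "test_fun_pos \<phi>"
  shows test_fun_pos_continuous: "continuous_on UNIV \<phi>"
    and test_fun_pos_bounded: "\<exists>\<Phi>. \<forall>t. \<bar>\<phi> t\<bar> \<le> \<Phi>"
proof -
  obtain a c where support: "a \<le> c" "\<And>x. x \<notin> {a..c} \<Longrightarrow> \<phi> x = 0"
    using assms by (auto simp: test_fun_pos_def)
  have "((deriv ^^ 0) \<phi>) differentiable (at x)" for x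
    using assms unfolding test_fun_pos_def by blast
  then have "\<phi> differentiable (at x)" for x
    by simp
  then show \<phi>_continuous: "continuous_on UNIV \<phi>"
    by (intro continuous_at_imp_continuous_on ballI differentiable_imp_continuous_within)
  have "continuous_on {a..c} (\<lambda>x. \<bar>\<phi> x\<bar>)"
    by (intro continuous_intros continuous_on_subset[OF \<phi>_continuous]) auto
  then obtain y where maximum: "\<And>x. x \<in> {a..c} \<Longrightarrow> \<bar>\<phi> x\<bar> \<le> \<bar>\<phi> y\<bar>"
    using continuous_attains_sup[of "{a..c}" "\<lambda>x. \<bar>\<phi> x\<bar>"] support(1) by force
  have "\<bar>\<phi> x\<bar> \<le> \<bar>\<phi> y\<bar>" for x
    using maximum[of x] support(2)[of x] by (cases "x \<in> {a..c}") auto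
  then show "\<exists>\<Phi>. \<forall>t. \<bar>\<phi> t\<bar> \<le> \<Phi>"
    by blast
qed

locale switched_brownian = drifted_brownian M W m D0
  for M :: "'a measure" and W :: "real \<Rightarrow> 'a \<Rightarrow> real" and m D0 :: real +
  fixes r b D1 T :: real and q sig :: "real \<Rightarrow> real \<Rightarrow> 'a \<Rightarrow> real"
  assumes m_pos: "0 < m" and r_pos: "0 < r" and b_pos: "0 < b" and D1_nonneg: "0 \<le> D1"
    and T_nonneg: "0 \<le> T"
    and solution: "0 < \<epsilon> \<Longrightarrow> \<omega> \<in> space M \<Longrightarrow>
      switching_solution m r b D0 D1 T \<epsilon> (\<lambda>t. W t \<omega>) (\<lambda>t. q \<epsilon> t \<omega>) (\<lambda>t. sig \<epsilon> t \<omega>)"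
begin

definition pairing_error :: "(real \<Rightarrow> real) \<Rightarrow> real \<Rightarrow> 'a \<Rightarrow> real" where
  "pairing_error \<phi> \<epsilon> \<omega> = pairing (\<lambda>t. sig \<epsilon> t \<omega>) \<phi> - impulse_pairing b T (E \<omega>) \<phi>"

lemma AE_regular_switching_family:
  "AE \<omega> in M. regular_switching_family m D0 b T (\<lambda>t. W t \<omega>) r D1 (\<lambda>\<epsilon> t. q \<epsilon> t \<omega>) (\<lambda>\<epsilon> t. sig \<epsilon> t \<omega>)"
  using AE_regular_energy_path[OF m_pos b_pos T_nonneg] AE_space
proof eventually_elim
  case (elim \<omega>)
  interpret regular_energy_path "E \<omega>" b T
    by fact
  show ?case
    using r_pos D1_nonneg W_continuous W_0 solution elim(2) by unfold_locales auto
qed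

lemma pairing_error_dominated:
  assumes test_function: "continuous_on UNIV \<phi>" "\<And>t. \<bar>\<phi> t\<bar> \<le> \<Phi>"
  obtains G where "G \<in> borel_measurable M" "(\<integral>\<^sup>+\<omega>. G \<omega> \<partial>M) < \<infinity>"
    "\<And>\<epsilon>. 0 < \<epsilon> \<Longrightarrow> AE \<omega> in M. ennreal ((pairing_error \<phi> \<epsilon> \<omega>)\<^sup>2) \<le> G \<omega>"
proof -
  obtain K where [measurable]: "K \<in> borel_measurable M"
    and K_moment: "\<And>\<omega>. 1 \<le> K \<omega>" "(\<integral>\<^sup>+\<omega>. ennreal (K \<omega> ^ 8) \<partial>M) < \<infinity>"
    and hoelder: "AE \<omega> in M. hoelder_on (1 / 3) (K \<omega>) {0..T} (\<lambda>t. W t \<omega>)"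
    using W_hoelder[of "1 / 3" 4 T] by auto
  define C where "C = switching_family.error_constant m D0 b T D1 \<Phi>"
  show ?thesis
  proof (rule that[of "\<lambda>\<omega>. ennreal (C\<^sup>2) * ennreal (K \<omega> ^ 8)"])
    have "(\<integral>\<^sup>+\<omega>. ennreal (C\<^sup>2) * ennreal (K \<omega> ^ 8) \<partial>M)
        = ennreal (C\<^sup>2) * (\<integral>\<^sup>+\<omega>. ennreal (K \<omega> ^ 8) \<partial>M)"
      by (rule nn_integral_cmult) measurable
    then show "(\<integral>\<^sup>+\<omega>. ennreal (C\<^sup>2) * ennreal (K \<omega> ^ 8) \<partial>M) < \<infinity>"
      using K_moment(2) by (simp add: ennreal_mult_less_top)
    show "AE \<omega> in M. ennreal ((pairing_error \<phi> \<epsilon> \<omega>)\<^sup>2) \<le> ennreal (C\<^sup>2) * ennreal (K \<omega> ^ 8)"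
      if "0 < \<epsilon>" for \<epsilon>
      using hoelder AE_regular_switching_family
    proof eventually_elim
      case (elim \<omega>)
      interpret family: regular_switching_family m D0 b T "\<lambda>t. W t \<omega>" r D1 "\<lambda>\<epsilon> t. q \<epsilon> t \<omega>"
          "\<lambda>\<epsilon> t. sig \<epsilon> t \<omega>"
        by fact
      have "\<bar>pairing_error \<phi> \<epsilon> \<omega>\<bar> \<le> C * K \<omega> ^ 4"
        unfolding pairing_error_def C_def using that D_nonzero K_moment(1) elim(1) test_function
        by (rule family.pairing_error_le_power4)
      then have "(pairing_error \<phi> \<epsilon> \<omega>)\<^sup>2 \<le> (C * K \<omega> ^ 4)\<^sup>2"
        by (rule abs_le_square_iff[THEN iffD1, OF order_trans]) simp
      also have "\<dots> = C\<^sup>2 * K \<omega> ^ 8"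
        by (simp add: power_mult_distrib flip: power_mult)
      finally show ?case
        by (simp add: ennreal_leI flip: ennreal_mult)
    qed
  qed measurable
qed

lemma AE_pairing_error_tendsto:
  assumes "continuous_on UNIV \<phi>"
  shows "AE \<omega> in M. ((\<lambda>\<epsilon>. pairing_error \<phi> \<epsilon> \<omega>) \<longlongrightarrow> 0) (at_right 0)"
  using AE_regular_switching_family
proof eventually_elim
  case (elim \<omega>)
  interpret family: regular_switching_family m D0 b T "\<lambda>t. W t \<omega>" r D1 "\<lambda>\<epsilon> t. q \<epsilon> t \<omega>"
      "\<lambda>\<epsilon> t. sig \<epsilon> t \<omega>"
    by fact
  show ?case
    unfolding pairing_error_def by (rule LIM_zero[OF family.pairing_tendsto[OF assms]])
qed

theorem mean_square_pairing_error_tendsto: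
  assumes test_function: "continuous_on UNIV \<phi>" "\<And>t. \<bar>\<phi> t\<bar> \<le> \<Phi>"
  shows "((\<lambda>\<epsilon>. \<integral>\<^sup>+\<omega>. ennreal ((pairing_error \<phi> \<epsilon> \<omega>)\<^sup>2) \<partial>M) \<longlongrightarrow> 0) (at_right 0)"
proof -
  obtain G where dominating: "G \<in> borel_measurable M" "(\<integral>\<^sup>+\<omega>. G \<omega> \<partial>M) < \<infinity>"
    "\<And>\<epsilon>. 0 < \<epsilon> \<Longrightarrow> AE \<omega> in M. ennreal ((pairing_error \<phi> \<epsilon> \<omega>)\<^sup>2) \<le> G \<omega>"
    using pairing_error_dominated[OF test_function] by blast
  have "AE \<omega> in M. ((\<lambda>\<epsilon>. ennreal ((pairing_error \<phi> \<epsilon> \<omega>)\<^sup>2)) \<longlongrightarrow> 0) (at_right 0)"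
    using AE_pairing_error_tendsto[OF test_function(1)]
  proof eventually_elim
    case (elim \<omega>)
    from tendsto_ennrealI[OF tendsto_power[OF elim, of 2]] show ?case
      by simp
  qed
  with dominating show ?thesis
    by (rule nn_integral_dominated_at_right_tendsto_0)
qed

end

theorem theorem2:
  fixes M :: "'a measure" and W :: "real \<Rightarrow> 'a \<Rightarrow> real"
    and q sig :: "real \<Rightarrow> real \<Rightarrow> 'a \<Rightarrow> real"
    and m r b D0 D1 T :: real and \<phi> :: "real \<Rightarrow> real"
  assumes BM: "brownian_motion M W"
    and m: "0 < m" and r: "0 < r" and b: "0 < b"
    and D: "0 < D0" "D0 \<le> D1" and T: "0 \<le> T"
    and phi: "test_fun_pos \<phi>"
    and sol: "\<And>\<epsilon> \<omega>. 0 < \<epsilon> \<Longrightarrow> \<omega> \<in> space M \<Longrightarrow>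
       switching_solution m r b D0 D1 T \<epsilon> (\<lambda>t. W t \<omega>) (\<lambda>t. q \<epsilon> t \<omega>) (\<lambda>t. sig \<epsilon> t \<omega>)"
  shows "((\<lambda>\<epsilon>. \<integral>\<^sup>+ \<omega>. ennreal
            (((LBINT t:{0<..}. sig \<epsilon> t \<omega> * \<phi> t)
              - b * (\<Sum>i\<in>{1..count_hits (\<lambda>t. m * t + D0 * W t \<omega>) b T}.
                       \<phi> (hit_time (\<lambda>t. m * t + D0 * W t \<omega>) (real i * b)))) ^ 2) \<partial>M)
          \<longlongrightarrow> 0) (at_right 0)"
proof -
  interpret switched_brownian M W m D0 r b D1 T q sig
    using BM m r b D T sol by unfold_locales auto
  obtain \<Phi> where "\<And>t. \<bar>\<phi> t\<bar> \<le> \<Phi>"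
    using test_fun_pos_bounded[OF phi] by blast
  with test_fun_pos_continuous[OF phi]
  have "((\<lambda>\<epsilon>. \<integral>\<^sup>+\<omega>. ennreal ((pairing_error \<phi> \<epsilon> \<omega>)\<^sup>2) \<partial>M) \<longlongrightarrow> 0) (at_right 0)"
    by (rule mean_square_pairing_error_tendsto)
  then show ?thesis
    by (simp only: pairing_error_def pairing_def impulse_pairing_def energy_def)
qed

end
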